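(* Let $M$ be a purely 2-unrectifiable metric space and let $[\gamma]$ be a homotopy class of Lipschitz paths in $M$ with length minimizer $\gamma_\infty\in[\gamma]$, i.e. $\ell(\gamma_\infty)=\inf\{\ell(\alpha)\mid\alpha\in[\gamma]\}$. Assume additionally that $\gamma_\infty$ is arc length parametrized. Let $\gamma:I\to M$ be a Lipschitz path that is homotopic rel endpoints to $\gamma_\infty$, and let $H:I\times I\to M$ be a Lipschitz homotopy from $\gamma$ to $\gamma_\infty$. Let $T$, $\psi:I\times I\to T$, $\varphi:T\to M$ be the metric tree and maps associated with $H$ (as defined in the context), let $\eta:I\to T$ be the geodesic in $T$ from $\psi(0,0)$ to $\psi(1,0)$, and put $\gamma_\infty':=\varphi\circ\eta:I\to M$. Then $\gamma_\infty'=\gamma_\infty$. Furthermore, $\operatorname{Im}(\gamma_\infty)\subset\operatorname{Im}(\gamma)$.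
   Context: $I=[0,1]$ with the Euclidean metric; all paths have domain $I$; $I\times I$ carries the $L^1$ metric $d^1((s,t),(s',t'))=|s-s'|+|t-t'|$. $\ell$ denotes the length of a path in $M$. A metric space $M$ is purely 2-unrectifiable (in the sense of Ambrosio-Kirchheim) if for every Borel set $S\subset\mathbb{R}^2$ and every Lipschitz map $f:S\to M$, the 2-dimensional Hausdorff measure of $f(S)$ is zero. Two Lipschitz paths $\gamma,\gamma':I\to M$ are homotopic rel endpoints if $\gamma(0)=\gamma'(0)$, $\gamma(1)=\gamma'(1)$, and there is a Lipschitz map $H:I\times I\to M$ (a homotopy from $\gamma$ to $\gamma'$) with $H(t,0)=\gamma(t)$, $H(t,1)=\gamma'(t)$, $H(0,s)=\gamma(0)$, $H(1,s)=\gamma(1)$ for all $s,t\in I$. The homotopy class $[\gamma]$ is the set of all Lipschitz paths homotopic rel endpoints to $\gamma$. A path $\eta:I\to M$ is arc length parametrized if $\ell(\eta|_{[t,t']})=\ell(\eta)\,|t'-t|$ for all $t\le t'$ in $I$. A path $\eta$ from $x$ to $y$ in a metric space $(N,d_N)$ is a geodesic if $d_N(\eta(t),\eta(t'))=d_N(x,y)|t'-t|$ for all $t,t'\in I$. A metric tree is a non-empty metric space in which any two points are joined by a unique arc and by a geodesic. Tree associated with $H$: for $a,a'\in I\times I$ let $d_H(a,a')=\inf\{\ell(H\circ c)\mid c\text{ a Lipschitz path in }I\times I\text{ from }a\text{ to }a'\}$, a pseudo-metric. Let $T=(I\times I)/\!\sim$ with $a\sim a'$ iff $d_H(a,a')=0$,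 with metric $d_T([a],[a'])=d_H(a,a')$; $\psi(a)=[a]$ is the quotient map, and $\varphi([a])=H(a)$, which is well defined, so $H=\varphi\circ\psi$. By a theorem of Wenger and Young, since $M$ is purely 2-unrectifiable, $T$ is a metric tree; also $\psi$ is $\operatorname{Lip}(H)$-Lipschitz and $\varphi$ is 1-Lipschitz. *)

theory Defs
  imports "HOL-Analysis.Analysis"
begin

section \<open>Hausdorff measure and pure 2-unrectifiability\<close>

text \<open>
  Covering sets are required to be bounded because \<^const>\<open>diameter\<close> is unspecified on unbounded
  sets; empty covering sets contribute nothing, also for \<open>d = 0\<close>.  The normalising constant is the
  usual one, making the measure agree with Lebesgue measure on d-dimensional Euclidean space.
\<close>

definition hausdorff_premeasure :: "nat \<Rightarrow> real \<Rightarrow> 'a::metric_space set \<Rightarrow> ennreal" where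
  "hausdorff_premeasure d \<delta> A =
     (INF E \<in> {E :: nat \<Rightarrow> 'a set. A \<subseteq> (\<Union>i. E i) \<and> (\<forall>i. bounded (E i) \<and> diameter (E i) \<le> \<delta>)}.
        \<Sum>i. if E i = {} then 0 else ennreal (unit_ball_vol (real d) * (diameter (E i) / 2) ^ d))"

definition hausdorff_measure :: "nat \<Rightarrow> 'a::metric_space set \<Rightarrow> ennreal" where
  "hausdorff_measure d A = (SUP \<delta> \<in> {0<..}. hausdorff_premeasure d \<delta> A)"

definition purely_2_unrectifiable :: "'a::metric_space set \<Rightarrow> bool" where
  "purely_2_unrectifiable M \<longleftrightarrow>
     (\<forall>S \<in> sets (borel :: (real \<times> real) measure). \<forall>f L.
        L-lipschitz_on S f \<and> f ` S \<subseteq> M \<longrightarrow> hausdorff_measure 2 (f ` S) = 0)"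

section \<open>Paths\<close>

text \<open>
  Paths are total functions on the reals of which only the values on \<open>{0..1}\<close> matter.
\<close>

definition lipschitz_path :: "(real \<Rightarrow> 'a::metric_space) \<Rightarrow> bool" where
  "lipschitz_path \<gamma> \<longleftrightarrow> (\<exists>L. L-lipschitz_on {0..1} \<gamma>)"

definition length_on :: "real \<Rightarrow> real \<Rightarrow> (real \<Rightarrow> 'a::metric_space) \<Rightarrow> ennreal" where
  "length_on a b \<gamma> =
     (SUP (n, t) \<in> {(n, t :: nat \<Rightarrow> real). (\<forall>i\<le>n. t i \<in> {a..b}) \<and> (\<forall>i<n. t i \<le> t (Suc i))}.
        \<Sum>i<n. ennreal (dist (\<gamma> (t i)) (\<gamma> (t (Suc i)))))"

abbreviation path_length :: "(real \<Rightarrow> 'a::metric_space) \<Rightarrow> ennreal" where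
  "path_length \<equiv> length_on 0 1"

definition arc_length_parametrized :: "(real \<Rightarrow> 'a::metric_space) \<Rightarrow> bool" where
  "arc_length_parametrized \<eta> \<longleftrightarrow>
     (\<forall>t \<in> {0..1}. \<forall>t' \<in> {0..1}. t \<le> t' \<longrightarrow>
        length_on t t' \<eta> = path_length \<eta> * ennreal \<bar>t' - t\<bar>)"

text \<open>
  Geodesics from \<open>x\<close> to \<open>y\<close> in a space given by a carrier \<open>N\<close> and a distance function \<open>d\<close>.
\<close>

definition geodesic :: "'b set \<Rightarrow> ('b \<Rightarrow> 'b \<Rightarrow> real) \<Rightarrow> 'b \<Rightarrow> 'b \<Rightarrow> (real \<Rightarrow> 'b) \<Rightarrow> bool" where
  "geodesic N d x y \<eta> \<longleftrightarrow>
     \<eta> ` {0..1} \<subseteq> N \<and> \<eta> 0 = x \<and> \<eta> 1 = y \<and>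
     (\<forall>t \<in> {0..1}. \<forall>t' \<in> {0..1}. d (\<eta> t) (\<eta> t') = d x y * \<bar>t' - t\<bar>)"

section \<open>Lipschitz homotopies\<close>

definition unit_square :: "(real \<times> real) set" where
  "unit_square = {0..1} \<times> {0..1}"

text \<open>
  The square carries the \<open>L\<^sup>1\<close> metric, whereas \<^const>\<open>dist\<close> on the product type is Euclidean.
\<close>

definition d1 :: "real \<times> real \<Rightarrow> real \<times> real \<Rightarrow> real" where
  "d1 a a' = \<bar>fst a - fst a'\<bar> + \<bar>snd a - snd a'\<bar>"

definition lipschitz_map_square :: "(real \<times> real \<Rightarrow> 'a::metric_space) \<Rightarrow> bool" where
  "lipschitz_map_square H \<longleftrightarrow>
     (\<exists>L\<ge>0. \<forall>a \<in> unit_square. \<forall>a' \<in> unit_square. dist (H a) (H a') \<le> L * d1 a a')"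

definition lipschitz_path_square ::
  "real \<times> real \<Rightarrow> real \<times> real \<Rightarrow> (real \<Rightarrow> real \<times> real) \<Rightarrow> bool" where
  "lipschitz_path_square a a' c \<longleftrightarrow>
     c ` {0..1} \<subseteq> unit_square \<and> c 0 = a \<and> c 1 = a' \<and>
     (\<exists>L\<ge>0. \<forall>t \<in> {0..1}. \<forall>t' \<in> {0..1}. d1 (c t) (c t') \<le> L * \<bar>t - t'\<bar>)"

definition lipschitz_homotopy ::
  "(real \<Rightarrow> 'a::metric_space) \<Rightarrow> (real \<Rightarrow> 'a) \<Rightarrow> (real \<times> real \<Rightarrow> 'a) \<Rightarrow> bool" where
  "lipschitz_homotopy \<gamma> \<gamma>' H \<longleftrightarrow>
     lipschitz_map_square H \<and>
     (\<forall>t \<in> {0..1}. H (t, 0) = \<gamma> t \<and> H (t, 1) = \<gamma>' t) \<and>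
     (\<forall>s \<in> {0..1}. H (0, s) = \<gamma> 0 \<and> H (1, s) = \<gamma> 1)"

definition homotopic_rel_endpoints ::
  "(real \<Rightarrow> 'a::metric_space) \<Rightarrow> (real \<Rightarrow> 'a) \<Rightarrow> bool" where
  "homotopic_rel_endpoints \<gamma> \<gamma>' \<longleftrightarrow>
     lipschitz_path \<gamma> \<and> lipschitz_path \<gamma>' \<and> \<gamma> 0 = \<gamma>' 0 \<and> \<gamma> 1 = \<gamma>' 1 \<and>
     (\<exists>H. lipschitz_homotopy \<gamma> \<gamma>' H)"

definition homotopy_class :: "(real \<Rightarrow> 'a::metric_space) \<Rightarrow> (real \<Rightarrow> 'a) set" where
  "homotopy_class \<gamma> = {\<alpha>. homotopic_rel_endpoints \<alpha> \<gamma>}"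

definition length_minimizer :: "(real \<Rightarrow> 'a::metric_space) set \<Rightarrow> (real \<Rightarrow> 'a) \<Rightarrow> bool" where
  "length_minimizer C \<gamma> \<longleftrightarrow> \<gamma> \<in> C \<and> path_length \<gamma> = (INF \<alpha> \<in> C. path_length \<alpha>)"

section \<open>The tree associated with a homotopy\<close>

text \<open>
  For Lipschitz \<open>H\<close> and points of the square the infimum is finite (use the segment between the two
  points), so the conversion to a real number loses nothing.
\<close>

definition d_H :: "(real \<times> real \<Rightarrow> 'a::metric_space) \<Rightarrow> real \<times> real \<Rightarrow> real \<times> real \<Rightarrow> real" where
  "d_H H a a' = enn2real (INF c \<in> {c. lipschitz_path_square a a' c}. path_length (H \<circ> c))"

definition tree_rel ::
  "(real \<times> real \<Rightarrow> 'a::metric_space) \<Rightarrow> ((real \<times> real) \<times> (real \<times> real)) set" where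
  "tree_rel H = {(a, a'). a \<in> unit_square \<and> a' \<in> unit_square \<and> d_H H a a' = 0}"

definition tree :: "(real \<times> real \<Rightarrow> 'a::metric_space) \<Rightarrow> (real \<times> real) set set" where
  "tree H = unit_square // tree_rel H"

definition tree_psi :: "(real \<times> real \<Rightarrow> 'a::metric_space) \<Rightarrow> real \<times> real \<Rightarrow> (real \<times> real) set" where
  "tree_psi H a = tree_rel H `` {a}"

text \<open>
  \<open>d_H\<close> and \<open>H\<close> are constant on equivalence classes; \<^const>\<open>the_elem\<close> selects the common value.
\<close>

definition tree_dist ::
  "(real \<times> real \<Rightarrow> 'a::metric_space) \<Rightarrow> (real \<times> real) set \<Rightarrow> (real \<times> real) set \<Rightarrow> real" where
  "tree_dist H X Y = the_elem ((\<lambda>(a, a'). d_H H a a') ` (X \<times> Y))"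

definition tree_phi :: "(real \<times> real \<Rightarrow> 'a::metric_space) \<Rightarrow> (real \<times> real) set \<Rightarrow> 'a" where
  "tree_phi H X = the_elem (H ` X)"

end

theory Submission
  imports Defs "HOL-Complex_Analysis.Great_Picard"
begin

text \<open>
  That the quotient is a metric tree is never needed.  Pushing a path in the square linearly to the
  top edge shows that \<open>H\<close> maps every path from the left to the right side to a curve at least as
  long as the minimizer, so the top edge is a \<open>d_H\<close>-geodesic.  It remains to see that every path
  \<open>c\<close> from left to right meets, up to \<open>d_H\<close>-distance 0, a dense set of points of the top edge.
  For this one spans a square between a short piece of the top edge and the complementary path
  running along \<open>c\<close>, so that its vertical sides collapse to two points with images
  \<open>P \<noteq> Q\<close>.  Let \<open>g\<close> be the distance from \<open>P\<close> to the image point.  For almost every \<open>s\<close>,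
  an Eilenberg type inequality makes the image of \<open>{g = s}\<close> totally disconnected, and
  counting grid points makes \<open>{g = s}\<close> so thin that a path of bounded Lipschitz constant
  inside it joins top to bottom (Brouwer gives grid chains, Arzela--Ascoli their limit).  The image
  of that path is constant, so its ends have \<open>d_H\<close>-distance 0.
\<close>

section \<open>Fibres of sets of vanishing Hausdorff measure\<close>

text \<open>A constant image on a continuum inside \<open>{g = s}\<close> would not be enough:
  \<open>d_H\<close> only sees Lipschitz paths, and a continuum may carry none between its ends.
  This is why two almost-everywhere statements are combined at one level: a thin image makes the map
  constant along the level, and a thin level in the square provides a path of finite speed along
  which it is constant. The meeting point lies on \<open>c\<close> for metric reasons. The rest of
  the complementary path consists of parts of the top edge outside the short piece, which are at
  positive \<open>d_H\<close>-distance from its interior because the top edge is a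
  \<open>d_H\<close>-geodesic, and of the sides of the original square, which collapse to the top
  corners. Arc length parametrization enters here, and again to make \<open>P\<close> and
  \<open>Q\<close> distinct: no piece of the top edge has a constant image unless the total length
  is 0, a case handled apart.\<close>

lemma hausdorff_null_cover:
  assumes "hausdorff_measure 2 A = 0" and "e > 0"
  obtains E :: "nat \<Rightarrow> 'a::metric_space set" and d :: "nat \<Rightarrow> real"
  where "A \<subseteq> (\<Union>i. E i)" "\<And>i. d i \<ge> 0" "\<And>i x y. x \<in> E i \<Longrightarrow> y \<in> E i \<Longrightarrow> dist x y \<le> d i"
    "(\<Sum>i. ennreal ((d i)\<^sup>2)) < ennreal e"
proof -
  \<comment> \<open>Coverings at the single scale 1 suffice, since a vanishing supremum forces every
    premeasure to vanish.\<close>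
  have "hausdorff_premeasure 2 1 A \<le> hausdorff_measure 2 A"
    unfolding hausdorff_measure_def by (intro SUP_upper) auto
  then have "hausdorff_premeasure 2 1 A < ennreal (e/2)"
    using assms by simp
  then obtain E where E: "A \<subseteq> (\<Union>i. E i)" "\<And>i. bounded (E i)"
    and lt: "(\<Sum>i. if E i = {} then 0 else ennreal (unit_ball_vol (real 2) * (diameter (E i) / 2)^2)) < ennreal (e/2)"
    unfolding hausdorff_premeasure_def INF_less_iff by auto
  define d where "d i = (if E i = {} then 0 else diameter (E i))" for i
  \<comment> \<open>The factor 2 absorbs the normalisation: a covering set contributes
    \<open>pi / 4\<close> times its squared diameter, and \<open>4 / pi \<le> 2\<close>.\<close>
  have le: "ennreal ((d i)\<^sup>2) \<le> 2 * (if E i = {} then 0 else ennreal (unit_ball_vol (real 2) * (diameter (E i) / 2)^2))" for i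
  proof (cases "E i = {}")
    case False
    have "(diameter (E i))\<^sup>2 * 2 \<le> (diameter (E i))\<^sup>2 * pi"
      using pi_gt3 by (intro mult_left_mono) auto
    then have "(diameter (E i))\<^sup>2 \<le> 2 * (pi * (diameter (E i) / 2)^2)"
      by (simp add: power_divide algebra_simps)
    then have "ennreal ((diameter (E i))\<^sup>2) \<le> ennreal (2 * (pi * (diameter (E i) / 2)^2))"
      by (rule ennreal_leI)
    also have "\<dots> = 2 * ennreal (pi * (diameter (E i) / 2)^2)"
      by (simp add: ennreal_mult)
    finally show ?thesis using False by (simp add: d_def unit_ball_vol_2)
  qed (simp add: d_def)
  have "(\<Sum>i. ennreal ((d i)\<^sup>2)) \<le> (\<Sum>i. 2 * (if E i = {} then 0 else ennreal (unit_ball_vol (real 2) * (diameter (E i) / 2)^2)))"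
    by (intro suminf_le le) auto
  also have "\<dots> = 2 * (\<Sum>i. (if E i = {} then 0 else ennreal (unit_ball_vol (real 2) * (diameter (E i) / 2)^2)))"
    by simp
  also have "\<dots> < 2 * ennreal (e/2)"
    using lt by (intro ennreal_mult_strict_left_mono) auto
  also have "\<dots> = ennreal e"
    using \<open>e > 0\<close> by (simp flip: ennreal_numeral ennreal_mult)
  finally have "(\<Sum>i. ennreal ((d i)\<^sup>2)) < ennreal e" .
  moreover have "dist x y \<le> d i" if "x \<in> E i" "y \<in> E i" for i x y
    using diameter_bounded_bound[OF E(2) that] that by (auto simp: d_def)
  moreover have "d i \<ge> 0" for i
    using diameter_ge_0[OF E(2)] by (simp add: d_def)
  ultimately show ?thesis using that E(1) by blast
qed

text \<open>Distance from \<open>x\<close> is 1-Lipschitz and maps a connected set containing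
  \<open>x\<close> and \<open>y\<close> onto at least \<open>{0..dist x y}\<close>. Covering sets of
  small total diameter have images of small total Lebesgue measure, too small for that
  interval.\<close>

lemma connected_eq_if_small_covers:
  fixes C :: "'a::metric_space set"
  assumes C: "connected C" "x \<in> C" "y \<in> C"
    and small: "\<And>e. e > 0 \<Longrightarrow> \<exists>(E :: nat \<Rightarrow> 'a set) d. C \<subseteq> (\<Union>i. E i) \<and> (\<forall>i. d i \<ge> 0) \<and>
      (\<forall>i. \<forall>u\<in>E i. \<forall>v\<in>E i. dist u v \<le> d i) \<and> (\<Sum>i. ennreal (d i)) < ennreal e"
  shows "x = y"
proof (rule ccontr)
  assume "x \<noteq> y"
  then have "dist x y / 2 > 0" by simp
  from small[OF this] obtain E :: "nat \<Rightarrow> 'a set" and d where E: "C \<subseteq> (\<Union>i. E i)" "\<And>i. d i \<ge> 0"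
    "\<And>i u v. u \<in> E i \<Longrightarrow> v \<in> E i \<Longrightarrow> dist u v \<le> d i"
    and lt: "(\<Sum>i. ennreal (d i)) < ennreal (dist x y / 2)" by metis
  \<comment> \<open>\<open>r i\<close> is the distance from \<open>x\<close> to some point of
    \<open>E i\<close>, so the distances to all its points are within \<open>d i\<close> of it. The
    resulting interval has length \<open>2 * d i\<close>, whence the threshold
    \<open>dist x y / 2\<close>.\<close>
  define r where "r i = dist x (SOME u. u \<in> E i)" for i
  have "connected (dist x ` C)"
    by (intro connected_continuous_image C continuous_intros)
  then have sub: "{0..dist x y} \<subseteq> dist x ` C"
    using C by (metis connected_contains_Icc dist_self image_eqI)
  have "dist x ` C \<subseteq> (\<Union>i. {r i - d i..r i + d i})"
  proof clarify
    fix u assume "u \<in> C"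
    then obtain i where i: "u \<in> E i" using E by blast
    then have "dist (SOME u. u \<in> E i) u \<le> d i"
      by (intro E(3)[OF someI])
    then have "dist x u \<in> {r i - d i..r i + d i}"
      using dist_triangle[of x u "SOME u. u \<in> E i"] dist_triangle[of x "SOME u. u \<in> E i" u]
      by (simp add: r_def dist_commute)
    then show "dist x u \<in> (\<Union>i. {r i - d i..r i + d i})" by blast
  qed
  then have "emeasure lborel {0..dist x y} \<le> emeasure lborel (\<Union>i. {r i - d i..r i + d i})"
    using sub by (intro emeasure_mono) auto
  also have "\<dots> \<le> (\<Sum>i. emeasure lborel {r i - d i..r i + d i})"
    by (intro emeasure_subadditive_countably) auto
  also have "\<dots> = (\<Sum>i. 2 * ennreal (d i))"
    using E(2) by (intro suminf_cong) (simp add: ennreal_mult flip: ennreal_numeral)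
  also have "\<dots> = 2 * (\<Sum>i. ennreal (d i))"
    by simp
  also have "\<dots> < 2 * ennreal (dist x y / 2)"
    using lt by (intro ennreal_mult_strict_left_mono) auto
  also have "\<dots> = ennreal (dist x y)"
    by (simp flip: ennreal_numeral ennreal_mult)
  finally show False by simp
qed

text \<open>A covering set of size \<open>d\<close> can meet the fibre only over an interval of
  length \<open>2 * d\<close>, so integrating the covering sums of the fibres over \<open>s\<close>
  costs a second power of \<open>d\<close>. These integrals tend to 0 along the coverings, so almost
  every fibre has coverings with arbitrarily small sum of sizes. The exceptional null set is chosen
  before \<open>C\<close>, \<open>x\<close> and \<open>y\<close>.\<close>

lemma AE_connected_fibre_trivial:
  fixes A :: "'a::metric_space set" and h :: "'a \<Rightarrow> real"
  assumes null: "hausdorff_measure 2 A = 0" and h: "1-lipschitz_on A h"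
  shows "AE s in lborel. \<forall>C x y. connected C \<and> C \<subseteq> A \<inter> h -` {s} \<and> x \<in> C \<and> y \<in> C \<longrightarrow> x = y"
proof -
  have "\<exists>(E :: nat \<Rightarrow> 'a set) d. A \<subseteq> (\<Union>i. E i) \<and> (\<forall>i. d i \<ge> 0) \<and>
    (\<forall>i. \<forall>x\<in>E i. \<forall>y\<in>E i. dist x y \<le> d i) \<and> (\<Sum>i. ennreal ((d i)\<^sup>2)) < ennreal (1 / Suc n)" for n
    by (rule hausdorff_null_cover[OF null, of "1 / Suc n"]) (simp, metis)
  then obtain E :: "nat \<Rightarrow> nat \<Rightarrow> 'a set" and d where E: "\<And>n. A \<subseteq> (\<Union>i. E n i)" "\<And>n i. d n i \<ge> 0"
    "\<And>n i x y. x \<in> E n i \<Longrightarrow> y \<in> E n i \<Longrightarrow> dist x y \<le> d n i"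
    "\<And>n. (\<Sum>i. ennreal ((d n i)\<^sup>2)) < ennreal (1 / Suc n)"
    by metis
  \<comment> \<open>A sample value of \<open>h\<close> on \<open>A \<inter> E n i\<close>; by the
    Lipschitz bound \<open>J n i\<close> contains all values of \<open>h\<close> there. If the
    intersection is empty, the value is arbitrary and harmless.\<close>
  define r where "r n i = h (SOME u. u \<in> A \<inter> E n i)" for n i
  define J where "J n i = {r n i - d n i..r n i + d n i}" for n i
  \<comment> \<open>\<open>\<Phi> n s\<close> bounds the total size of the sets of the
    \<open>n\<close>-th covering that meet the fibre over \<open>s\<close>. Its infimum over
    \<open>n\<close> is enough, because one good covering per tolerance suffices.\<close>
  define \<Phi> where "\<Phi> n s = (\<Sum>i. ennreal (d n i) * indicator (J n i) s)" for n and s :: real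
  have [measurable]: "\<Phi> n \<in> borel_measurable lborel" for n
    unfolding \<Phi>_def J_def by measurable
  have int: "(\<integral>\<^sup>+s. \<Phi> n s \<partial>lborel) \<le> 2 * ennreal (1 / Suc n)" for n
  proof -
    have "(\<integral>\<^sup>+s. \<Phi> n s \<partial>lborel) = (\<Sum>i. \<integral>\<^sup>+s. ennreal (d n i) * indicator (J n i) s \<partial>lborel)"
      unfolding \<Phi>_def J_def by (intro nn_integral_suminf) auto
    also have "\<dots> = (\<Sum>i. 2 * ennreal ((d n i)\<^sup>2))"
      using E(2) by (intro suminf_cong)
        (simp add: J_def nn_integral_cmult_indicator power2_eq_square algebra_simps flip: ennreal_mult ennreal_numeral)
    also have "\<dots> = 2 * (\<Sum>i. ennreal ((d n i)\<^sup>2))" by simp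
    also have "\<dots> \<le> 2 * ennreal (1 / Suc n)"
      using E(4)[of n] by (intro mult_left_mono) auto
    finally show ?thesis .
  qed
  have "(\<integral>\<^sup>+s. (INF n. \<Phi> n s) \<partial>lborel) \<le> 0"
  proof (rule ennreal_le_epsilon)
    fix e :: real assume "e > 0"
    then obtain n where n: "1 / real (Suc n) < e/2"
      by (metis half_gt_zero nat_approx_posE)
    have "(\<integral>\<^sup>+s. (INF n. \<Phi> n s) \<partial>lborel) \<le> (\<integral>\<^sup>+s. \<Phi> n s \<partial>lborel)"
      by (intro nn_integral_mono INF_lower) auto
    also have "\<dots> \<le> 2 * ennreal (1 / Suc n)" by (rule int)
    also have "\<dots> = ennreal (2 * (1 / Suc n))" by (subst ennreal_mult) auto
    also have "\<dots> \<le> ennreal e" using n by (intro ennreal_leI) auto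
    finally show "(\<integral>\<^sup>+s. (INF n. \<Phi> n s) \<partial>lborel) \<le> 0 + ennreal e" by simp
  qed
  then have "AE s in lborel. (INF n. \<Phi> n s) = 0"
    by (subst (asm) le_zero_eq, subst (asm) nn_integral_0_iff_AE) auto
  then show ?thesis
  proof eventually_elim
    case (elim s)
    show ?case
    proof (intro allI impI, elim conjE)
      fix C x y assume C: "connected C" "C \<subseteq> A \<inter> h -` {s}" "x \<in> C" "y \<in> C"
      show "x = y"
      proof (rule connected_eq_if_small_covers[OF C(1,3,4)])
        fix e :: real assume "e > 0"
        then have "(INF n. \<Phi> n s) < ennreal e" using elim by simp
        then obtain n where n: "\<Phi> n s < ennreal e" unfolding INF_less_iff by auto
        \<comment> \<open>Sets whose interval misses \<open>s\<close> do not meet the fibre and are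
          discarded; the rest has total size \<open>\<Phi> n s\<close>.\<close>
        define E' where "E' i = (if s \<in> J n i then E n i else {})" for i
        define d' where "d' i = d n i * indicator (J n i) s" for i
        have "C \<subseteq> (\<Union>i. E' i)"
        proof
          fix u assume u: "u \<in> C"
          then have uA: "u \<in> A" "h u = s" using C by auto
          then obtain i where i: "u \<in> E n i" using E by blast
          let ?w = "SOME u. u \<in> A \<inter> E n i"
          have w: "?w \<in> A \<inter> E n i" using i uA by (metis IntI someI)
          have "\<bar>h ?w - s\<bar> \<le> dist ?w u"
            using lipschitz_onD[OF h, of ?w u] uA w by (simp add: dist_real_def)
          also have "\<dots> \<le> d n i" using w i E(3) by blast
          finally have "s \<in> J n i" by (auto simp: J_def r_def)
          then show "u \<in> (\<Union>i. E' i)" using i by (auto simp: E'_def)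
        qed
        moreover have "(\<Sum>i. ennreal (d' i)) = \<Phi> n s"
          unfolding \<Phi>_def d'_def by (intro suminf_cong) (auto simp: indicator_def)
        ultimately show "\<exists>(E :: nat \<Rightarrow> 'a set) d. C \<subseteq> (\<Union>i. E i) \<and> (\<forall>i. d i \<ge> 0) \<and>
            (\<forall>i. \<forall>u\<in>E i. \<forall>v\<in>E i. dist u v \<le> d i) \<and> (\<Sum>i. ennreal (d i)) < ennreal e"
          using n E(2,3) by (intro exI[of _ E'] exI[of _ d']) (auto simp: E'_def d'_def)
      qed
    qed
  qed
qed

section \<open>Paths in level sets of functions on the square\<close>

text \<open>The tolerance \<open>l / n\<close> is what an \<open>l\<close>-Lipschitz function can
  change between a point and the nearest point of the grid of mesh \<open>1 / n\<close>, each
  coordinate being off by at most half a mesh. So every point of \<open>{g = s}\<close> has a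
  nearest grid point in this set.\<close>

definition grid_level :: "(real \<times> real \<Rightarrow> real) \<Rightarrow> real \<Rightarrow> nat \<Rightarrow> real \<Rightarrow> (nat \<times> nat) set" where
  "grid_level g l n s =
     {v \<in> {..n} \<times> {..n}. \<bar>g (real (fst v) / real n, real (snd v) / real n) - s\<bar> \<le> l / real n}"

lemma finite_grid_level [simp]: "finite (grid_level g l n s)"
  by (simp add: grid_level_def)

text \<open>
  Integrating the number of grid points over \<open>s\<close> gives \<open>(n + 1)\<^sup>2 * (2 * l / n)\<close>, which is
  linear in \<open>n\<close>; Fatou's lemma does the rest.
\<close>

lemma AE_few_grid_points:
  assumes "l \<ge> 0"
  shows "AE s in lborel. \<exists>K. \<exists>\<^sub>F n in sequentially. real (card (grid_level g l n s)) \<le> K * real n"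
proof -
  \<comment> \<open>\<open>I m v\<close> is the set of levels that count the grid point
    \<open>v\<close>, an interval of length \<open>2 * l / (m + 1)\<close>. The grid size is written
    \<open>Suc m\<close> to keep it positive.\<close>
  define I where "I m v = {s. \<bar>g (real (fst v) / real (Suc m), real (snd v) / real (Suc m)) - s\<bar> \<le> l / real (Suc m)}"
    for m and v :: "nat \<times> nat"
  have I_eq: "I m v = {g (real (fst v) / real (Suc m), real (snd v) / real (Suc m)) - l / real (Suc m)..
      g (real (fst v) / real (Suc m), real (snd v) / real (Suc m)) + l / real (Suc m)}" for m v
    by (auto simp: I_def abs_le_iff)
  define u where "u m s = ennreal (real (card (grid_level g l (Suc m) s)) / real (Suc m))" for m s
  have u: "u m s = (\<Sum>v\<in>{..Suc m} \<times> {..Suc m}. ennreal (1 / Suc m) * indicator (I m v) s)" for m s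
  proof -
    have count: "real (card {v \<in> A. Q v}) = (\<Sum>v\<in>A. of_bool (Q v))" if "finite A" for A :: "(nat \<times> nat) set" and Q
      using that by (simp add: Int_def)
    have "real (card (grid_level g l (Suc m) s)) = (\<Sum>v\<in>{..Suc m} \<times> {..Suc m}. indicator (I m v) s)"
      unfolding grid_level_def by (subst count) (simp_all add: I_def indicator_def)
    then have "u m s = ennreal (\<Sum>v\<in>{..Suc m} \<times> {..Suc m}. (1 / Suc m) * indicator (I m v) s)"
      by (simp add: u_def sum_divide_distrib[symmetric] sum_distrib_left[symmetric])
    also have "\<dots> = (\<Sum>v\<in>{..Suc m} \<times> {..Suc m}. ennreal ((1 / Suc m) * indicator (I m v) s))"
      by (subst sum_ennreal) auto
    also have "\<dots> = (\<Sum>v\<in>{..Suc m} \<times> {..Suc m}. ennreal (1 / Suc m) * indicator (I m v) s)"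
      by (intro sum.cong) (auto simp: indicator_def)
    finally show ?thesis .
  qed
  have [measurable]: "u m \<in> borel_measurable lborel" for m
    unfolding u I_eq by measurable
  have int: "(\<integral>\<^sup>+s. u m s \<partial>lborel) \<le> ennreal (8 * l)" for m
  proof -
    have "(\<integral>\<^sup>+s. u m s \<partial>lborel) = (\<Sum>v\<in>{..Suc m} \<times> {..Suc m}. ennreal (1 / Suc m) * emeasure lborel (I m v))"
      unfolding u by (subst nn_integral_sum) (auto simp: I_eq nn_integral_cmult_indicator)
    also have "\<dots> = (\<Sum>v\<in>{..Suc m} \<times> {..Suc m}. ennreal ((1 / Suc m) * (2 * l / Suc m)))"
      using \<open>l \<ge> 0\<close> by (intro sum.cong refl, subst ennreal_mult) (auto simp: I_eq add_divide_distrib[symmetric])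
    also have "\<dots> = ennreal (\<Sum>v\<in>{..Suc m} \<times> {..Suc m}. (1 / Suc m) * (2 * l / Suc m))"
      using \<open>l \<ge> 0\<close> by (intro sum_ennreal) auto
    also have "\<dots> \<le> ennreal (8 * l)"
    proof (rule ennreal_leI)
      \<comment> \<open>There are \<open>(m + 2)^2\<close> grid points at mesh
        \<open>1 / (m + 1)\<close>; this inequality is where \<open>8 * l\<close> comes
        from.\<close>
      have "(real m + 2)\<^sup>2 \<le> 4 * (real m + 1)\<^sup>2"
        by (simp add: power2_eq_square algebra_simps)
      then have "(2 * l) * (real m + 2)\<^sup>2 \<le> (2 * l) * (4 * (real m + 1)\<^sup>2)"
        using \<open>l \<ge> 0\<close> by (intro mult_left_mono) auto
      then show "(\<Sum>v\<in>{..Suc m} \<times> {..Suc m}. (1 / Suc m) * (2 * l / Suc m)) \<le> 8 * l"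
        by (simp add: card_cartesian_product divide_simps power2_eq_square) (simp add: algebra_simps)
    qed
    finally show ?thesis .
  qed
  have "(\<integral>\<^sup>+s. liminf (\<lambda>m. u m s) \<partial>lborel) \<le> liminf (\<lambda>m. \<integral>\<^sup>+s. u m s \<partial>lborel)"
    by (intro nn_integral_liminf) auto
  also have "\<dots> \<le> liminf (\<lambda>m. ennreal (8 * l))"
    using int by (intro Liminf_mono) auto
  also have "\<dots> < \<infinity>" by (simp add: Liminf_const)
  finally have "AE s in lborel. liminf (\<lambda>m. u m s) \<noteq> \<infinity>"
    by (intro nn_integral_noteq_infinite) auto
  then show ?thesis
  proof eventually_elim
    case (elim s)
    \<comment> \<open>The added 1 puts \<open>K\<close> strictly above the finite lower limit, so
      infinitely many indices stay below \<open>K\<close>.\<close>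
    define K where "K = enn2real (liminf (\<lambda>m. u m s)) + 1"
    have "liminf (\<lambda>m. u m s) < ennreal K"
      using elim by (cases "liminf (\<lambda>m. u m s)") (auto simp: K_def ennreal_less_iff)
    then have "\<not> (\<forall>\<^sub>F m in sequentially. ennreal K \<le> u m s)"
      using Liminf_bounded[of "ennreal K" "\<lambda>m. u m s" sequentially] by (auto simp: not_le)
    then have "\<exists>\<^sub>F m in sequentially. u m s < ennreal K"
      by (simp add: frequently_def not_less)
    then have "\<exists>\<^sub>F m in sequentially. real (card (grid_level g l (Suc m) s)) \<le> K * real (Suc m)"
      by (rule frequently_elim1) (auto simp: u_def ennreal_less_iff divide_simps mult.commute split: if_splits)
    then have "\<exists>\<^sub>F n in sequentially. real (card (grid_level g l n s)) \<le> K * real n"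
      using eventually_sequentially_Suc[of "\<lambda>n. \<not> real (card (grid_level g l n s)) \<le> K * real n"]
      unfolding frequently_def by blast
    then show ?case by blast
  qed
qed

section \<open>Crossing chains of grid points along a level set\<close>

lemma compact_unit_square: "compact unit_square"
  unfolding unit_square_def by (intro compact_Times compact_Icc)

lemma convex_unit_square: "convex unit_square"
  unfolding unit_square_def by (intro convex_Times) auto

text \<open>A Poincare-Miranda argument. The first coordinate of the fixed point equation for
  \<open>f\<close> forces \<open>g = s\<close>, because the strict signs on the sides exclude
  \<open>x = 0\<close> and \<open>x = 1\<close>; so the fixed point lies in \<open>A\<close> or
  \<open>B\<close>. There \<open>u\<close> is 1 or -1, and the second coordinate equation puts it on
  the bottom if it is in \<open>A\<close> and on the top if it is in \<open>B\<close>, exactly the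
  edges which these sets avoid.\<close>

lemma not_separated_level_set:
  fixes g :: "real \<times> real \<Rightarrow> real"
  assumes g: "continuous_on unit_square g"
    and left: "\<And>y. y \<in> {0..1} \<Longrightarrow> g (0, y) < s" and right: "\<And>y. y \<in> {0..1} \<Longrightarrow> g (1, y) > s"
    and Z: "closed A" "closed B" "A \<inter> B = {}" "{z \<in> unit_square. g z = s} \<subseteq> A \<union> B"
    and AB: "\<And>x. x \<in> {0..1} \<Longrightarrow> (x, 0) \<notin> A" "\<And>x. x \<in> {0..1} \<Longrightarrow> (x, 1) \<notin> B"
  shows False
proof -
  define S where "S = A \<union> {0..1} \<times> {1}"
  define T where "T = B \<union> {0..1} \<times> {0}"
  have "closed S" "closed T" "S \<inter> T = {}"
    using Z AB by (auto simp: S_def T_def intro!: closed_Un closed_Times)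
  then obtain u :: "real \<times> real \<Rightarrow> real" where u: "continuous_on UNIV u" "\<And>z. z \<in> S \<Longrightarrow> u z = 1" "\<And>z. z \<in> T \<Longrightarrow> u z = -1"
    by (rule Urysohn[of S T 1 "-1"]) auto
  define clamp :: "real \<Rightarrow> real" where "clamp t = max 0 (min 1 t)" for t
  define f where "f z = (clamp (fst z - (g z - s)), clamp (snd z - u z))" for z
  have "continuous_on unit_square f"
    unfolding f_def clamp_def using g continuous_on_subset[OF u(1) subset_UNIV]
    by (intro continuous_intros)
  moreover have "f \<in> unit_square \<rightarrow> unit_square"
    by (auto simp: f_def clamp_def unit_square_def)
  moreover have "unit_square \<noteq> {}" by (auto simp: unit_square_def)
  ultimately obtain z where z: "z \<in> unit_square" "f z = z"
    using brouwer[OF compact_unit_square convex_unit_square] by metis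
  obtain x y where xy: "z = (x, y)" by fastforce
  have x: "clamp (x - (g z - s)) = x" and y: "clamp (y - u z) = y"
    using z(2) by (simp_all add: f_def xy)
  have in01: "x \<in> {0..1}" "y \<in> {0..1}" using z by (auto simp: xy unit_square_def)
  have "x \<noteq> 0" using x left[OF in01(2)] by (auto simp: clamp_def xy)
  moreover have "x \<noteq> 1" using x right[OF in01(2)] by (auto simp: clamp_def xy)
  ultimately have "g z = s" using x in01 by (auto simp: clamp_def max_def min_def split: if_splits)
  then have "z \<in> A \<or> z \<in> B" using z Z by auto
  then consider "u z = 1" "z \<in> A" | "u z = -1" "z \<in> B"
    using u by (auto simp: S_def T_def)
  then show False
  proof cases
    case 1
    then have "y = 0" using y in01 by (auto simp: clamp_def)
    then show False using 1 AB in01 xy by auto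
  next
    case 2
    then have "y = 1" using y in01 by (auto simp: clamp_def)
    then show False using 2 AB in01 xy by auto
  qed
qed

text \<open>Adjacency by king moves, including staying put: closed boxes around grid points may
  touch at a corner only. Differences are taken in \<open>int\<close> since subtraction on
  \<open>nat\<close> is truncated.\<close>

definition grid_adj :: "((nat \<times> nat) \<times> (nat \<times> nat)) set" where
  "grid_adj = {(v, w). \<bar>int (fst v) - int (fst w)\<bar> \<le> 1 \<and> \<bar>int (snd v) - int (snd w)\<bar> \<le> 1}"

lemma nearest_grid_point:
  fixes x :: real
  assumes "x \<in> {0..1}" "n > 0"
  obtains i where "i \<le> n" "\<bar>x - real i / real n\<bar> \<le> 1 / (2 * real n)"
proof -
  define k where "k = round (x * real n)"
  have k: "\<bar>of_int k - x * real n\<bar> \<le> 1/2"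
    unfolding k_def by (rule of_int_round_abs_le)
  have "x * real n \<le> real n" "0 \<le> x * real n"
    using assms by (auto intro: mult_left_le_one_le)
  then have "k \<ge> 0" "k \<le> int n" using k by linarith+
  then have "nat k \<le> n" "real (nat k) = of_int k" by auto
  moreover have "\<bar>x - of_int k / real n\<bar> = \<bar>of_int k - x * real n\<bar> / real n"
    using \<open>n > 0\<close> by (simp add: field_simps abs_divide[symmetric] flip: abs_minus_commute)
  moreover have "\<dots> \<le> 1 / 2 / real n"
    using k by (intro divide_right_mono) auto
  ultimately show ?thesis using that[of "nat k"] by simp
qed

text \<open>Suppose no chain reaches the bottom. The closed boxes around the level grid points
  reachable from the top form \<open>A\<close>, those around the unreachable ones form
  \<open>B\<close>. Boxes that intersect belong to adjacent points, so reachability passes between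
  them and \<open>A\<close>, \<open>B\<close> are disjoint. By the tolerance in
  \<open>grid_level\<close> they cover the level set, which contradicts
  \<open>not_separated_level_set\<close>.\<close>

lemma grid_chain_crossing:
  fixes g :: "real \<times> real \<Rightarrow> real"
  assumes g: "l-lipschitz_on unit_square g" and n: "n > 0"
    and left: "\<And>y. y \<in> {0..1} \<Longrightarrow> g (0, y) < s" and right: "\<And>y. y \<in> {0..1} \<Longrightarrow> g (1, y) > s"
  shows "\<exists>v w. v \<in> grid_level g l n s \<and> snd v = n \<and> snd w = 0 \<and>
    (v, w) \<in> (grid_adj \<inter> grid_level g l n s \<times> grid_level g l n s)\<^sup>*"
proof (rule ccontr)
  assume none: "\<not> ?thesis"
  let ?V = "grid_level g l n s"
  let ?R = "grid_adj \<inter> ?V \<times> ?V"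
  define pt where "pt v = (real (fst v) / real n, real (snd v) / real n)" for v :: "nat \<times> nat"
  define box where "box v = cbox (pt v - (1 / (2 * real n), 1 / (2 * real n))) (pt v + (1 / (2 * real n), 1 / (2 * real n)))" for v
  have box: "(x, y) \<in> box v \<longleftrightarrow> \<bar>x - real (fst v) / real n\<bar> \<le> 1 / (2 * real n) \<and> \<bar>y - real (snd v) / real n\<bar> \<le> 1 / (2 * real n)" for x y v
    by (auto simp: box_def pt_def cbox_Pair_iff abs_le_iff)
  have adj: "\<bar>int i - int j\<bar> \<le> 1"
    if "\<bar>x - real i / real n\<bar> \<le> 1 / (2 * real n)" "\<bar>x - real j / real n\<bar> \<le> 1 / (2 * real n)" for x i j
  proof -
    have "\<bar>real i / real n - real j / real n\<bar> \<le> 1 / real n"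
      using that by linarith
    also have "\<bar>real i / real n - real j / real n\<bar> = \<bar>real i - real j\<bar> / real n"
      using n by (simp add: diff_divide_distrib[symmetric] abs_divide)
    finally have "\<bar>real i - real j\<bar> \<le> 1"
      using n by (simp add: divide_simps)
    then show ?thesis by linarith
  qed
  define U where "U = {w. \<exists>v\<in>?V. snd v = n \<and> (v, w) \<in> ?R\<^sup>*}"
  have reach: "w' \<in> U" if "w \<in> U" "w \<in> ?V" "w' \<in> ?V" "(x, y) \<in> box w" "(x, y) \<in> box w'" for w w' x y
  proof -
    have "(w, w') \<in> ?R"
      using that adj[of x "fst w" "fst w'"] adj[of y "snd w" "snd w'"] by (auto simp: box grid_adj_def)
    then show ?thesis using that(1) by (auto simp: U_def intro: rtrancl_into_rtrancl)
  qed
  define A where "A = (\<Union>v\<in>?V \<inter> U. box v)"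
  define B where "B = (\<Union>v\<in>?V - U. box v)"
  have small: "\<bar>real i / real n\<bar> \<le> 1 / (2 * real n) \<Longrightarrow> i = 0" for i
    using n by (cases i) (auto simp: divide_simps)
  have big: "\<bar>1 - real i / real n\<bar> \<le> 1 / (2 * real n) \<Longrightarrow> i = n" for i
  proof -
    assume a: "\<bar>1 - real i / real n\<bar> \<le> 1 / (2 * real n)"
    have "\<bar>real n - real i\<bar> = real n * \<bar>1 - real i / real n\<bar>"
      using n by (simp add: field_simps flip: abs_mult_pos)
    also have "\<dots> \<le> real n * (1 / (2 * real n))" using a by (intro mult_left_mono) auto
    also have "\<dots> < 1" using n by simp
    finally show "i = n" by linarith
  qed
  show False
  proof (rule not_separated_level_set[OF lipschitz_on_continuous_on[OF g] left right])
    show "closed A" "closed B"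
      by (auto simp: A_def B_def box_def intro!: closed_UN)
    show "A \<inter> B = {}"
      using reach by (force simp: A_def B_def)
    show "{z \<in> unit_square. g z = s} \<subseteq> A \<union> B"
    proof clarify
      fix x y assume xy: "(x, y) \<in> unit_square" "(x, y) \<notin> B" and s: "s = g (x, y)"
      obtain i j where ij: "i \<le> n" "\<bar>x - real i / real n\<bar> \<le> 1 / (2 * real n)"
          "j \<le> n" "\<bar>y - real j / real n\<bar> \<le> 1 / (2 * real n)"
        using nearest_grid_point[OF _ n] xy(1) by (metis mem_Sigma_iff unit_square_def)
      have insq: "(real i / real n, real j / real n) \<in> unit_square"
        using ij by (auto simp: unit_square_def divide_simps)
      have "\<bar>g (real i / real n, real j / real n) - s\<bar> \<le> l * dist (real i / real n, real j / real n) (x, y)"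
        using lipschitz_onD[OF g insq xy(1)] by (simp add: dist_real_def s)
      also have "dist (real i / real n, real j / real n) (x, y) \<le> \<bar>x - real i / real n\<bar> + \<bar>y - real j / real n\<bar>"
        unfolding dist_Pair_Pair dist_real_def by (rule order_trans[OF sqrt_sum_squares_le_sum_abs]) (simp add: abs_minus_commute)
      also have "\<dots> \<le> 1 / (2 * real n) + 1 / (2 * real n)" using ij by linarith
      also have "\<dots> = 1 / real n" by (simp add: field_simps)
      finally have "(i, j) \<in> ?V"
        using ij lipschitz_on_nonneg[OF g] by (simp add: grid_level_def mult_left_mono)
      moreover have "(x, y) \<in> box (i, j)" using ij by (simp add: box)
      ultimately show "(x, y) \<in> A" using xy(2) by (auto simp: A_def B_def)
    qed
    fix x :: real
    show "(x, 0) \<notin> A"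
    proof
      assume "(x, 0) \<in> A"
      then obtain w where w: "w \<in> U" "(x, 0) \<in> box w" by (auto simp: A_def)
      then have "snd w = 0" using small by (simp add: box)
      then show False using none w(1) unfolding U_def by blast
    qed
    \<comment> \<open>A box meeting the top edge has its centre in the top row, which is reachable
      by the empty chain.\<close>
    show "(x, 1) \<notin> B"
    proof
      assume "(x, 1) \<in> B"
      then obtain w where "w \<in> ?V" "w \<notin> U" "(x, 1) \<in> box w" by (auto simp: B_def)
      then show False using big by (auto simp: box U_def)
    qed
  qed auto
qed

section \<open>Lipschitz paths from grid chains, and their limit\<close>

lemma lipschitz_interpolation:
  fixes f :: "nat \<Rightarrow> 'b::real_normed_vector"
  assumes S: "convex S" and "e \<ge> 0"
    and "\<And>i. i \<le> m \<Longrightarrow> f i \<in> S" "\<And>i. i < m \<Longrightarrow> dist (f i) (f (Suc i)) \<le> e"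
  shows "\<exists>q. e-lipschitz_on {0..real m} q \<and> q ` {0..real m} \<subseteq> S \<and> (\<forall>i\<le>m. q (real i) = f i)"
  using assms(3,4)
proof (induction m)
  case 0
  then show ?case using \<open>e \<ge> 0\<close> by (intro exI[of _ "\<lambda>_. f 0"]) auto
next
  case (Suc m)
  then obtain q where q: "e-lipschitz_on {0..real m} q" "q ` {0..real m} \<subseteq> S" "\<And>i. i \<le> m \<Longrightarrow> q (real i) = f i"
    by (metis le_SucI less_SucI)
  define r where "r x = (1 - (x - real m)) *\<^sub>R f m + (x - real m) *\<^sub>R f (Suc m)" for x
  define q' where "q' x = (if x \<le> real m then q x else r x)" for x
  have "r x - r y = (x - y) *\<^sub>R (f (Suc m) - f m)" for x y
    by (simp add: r_def algebra_simps)
  then have "dist (r x) (r y) = dist (f m) (f (Suc m)) * dist x y" for x y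
    by (simp add: dist_norm norm_minus_commute mult.commute)
  then have "dist (r x) (r y) \<le> e * dist x y" for x y
    using Suc.prems(2)[of m] by (simp add: mult_right_mono)
  then have "e-lipschitz_on {real m..real (Suc m)} r"
    using \<open>e \<ge> 0\<close> by (intro lipschitz_onI)
  then have "e-lipschitz_on {0..real (Suc m)} q'"
    unfolding q'_def using q(1) q(3)[of m] by (intro lipschitz_on_concat) (auto simp: r_def)
  moreover have "r x \<in> S" if "real m \<le> x" "x \<le> real (Suc m)" for x
    unfolding r_def using that Suc.prems(1) by (intro convexD[OF S]) auto
  then have "q' ` {0..real (Suc m)} \<subseteq> S"
    using q(2) by (auto simp: q'_def)
  moreover have "q' (real i) = f i" if "i \<le> Suc m" for i
    using that q(3)[of i] by (cases "i = Suc m") (auto simp: q'_def r_def)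
  ultimately show ?case by blast
qed

text \<open>Pairs rather than points are counted because, in a finite relation, a reachable element
  is reached in at most as many steps as the relation has pairs. The 9 is the size of a king
  neighbourhood; truncation of \<open>k - 1\<close> at the border only shrinks it.\<close>

lemma card_grid_adj_le:
  assumes "finite V"
  shows "finite (grid_adj \<inter> V \<times> V)" "card (grid_adj \<inter> V \<times> V) \<le> 9 * card V"
proof -
  define nb where "nb v = {v} \<times> ({fst v - 1..fst v + 1} \<times> {snd v - 1..snd v + 1})" for v :: "nat \<times> nat"
  have c: "card (nb v) \<le> 9" for v
  proof -
    have *: "card {k - 1..k + 1} \<le> 3" for k :: nat by simp
    have "card (nb v) = card {fst v - 1..fst v + 1} * card {snd v - 1..snd v + 1}"
      by (simp add: nb_def card_cartesian_product)
    also have "\<dots> \<le> 3 * 3" by (intro mult_mono *) auto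
    finally show ?thesis by simp
  qed
  have sub: "grid_adj \<inter> V \<times> V \<subseteq> (\<Union>v\<in>V. nb v)"
    by (auto simp: grid_adj_def nb_def)
  have fin: "finite (\<Union>v\<in>V. nb v)"
    using assms by (auto simp: nb_def)
  show "finite (grid_adj \<inter> V \<times> V)" using sub fin by (rule finite_subset)
  have "card (grid_adj \<inter> V \<times> V) \<le> card (\<Union>v\<in>V. nb v)"
    by (rule card_mono[OF fin sub])
  also have "\<dots> \<le> (\<Sum>v\<in>V. card (nb v))" by (rule card_UN_le[OF assms])
  also have "\<dots> \<le> (\<Sum>v\<in>V. 9)" by (intro sum_mono c)
  finally show "card (grid_adj \<inter> V \<times> V) \<le> 9 * card V" by simp
qed

text \<open>With at most \<open>K * n\<close> level points a chain needs at most
  \<open>9 * K * n\<close> steps, each of length at most \<open>2 / n\<close>; traversed in unit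
  time, the polygon has Lipschitz constant \<open>18 * K\<close>, independent of \<open>n\<close>.
  The error \<open>3 * l / n\<close> is the grid tolerance \<open>l / n\<close> plus the variation
  \<open>2 * l / n\<close> along one step.\<close>

lemma grid_path_crossing:
  fixes g :: "real \<times> real \<Rightarrow> real"
  assumes g: "l-lipschitz_on unit_square g" and n: "n > 0"
    and left: "\<And>y. y \<in> {0..1} \<Longrightarrow> g (0, y) < s" and right: "\<And>y. y \<in> {0..1} \<Longrightarrow> g (1, y) > s"
    and card: "real (card (grid_level g l n s)) \<le> K * real n"
  shows "\<exists>p :: real \<Rightarrow> real \<times> real. (18 * K)-lipschitz_on {0..1} p \<and> p ` {0..1} \<subseteq> unit_square \<and> snd (p 0) = 1 \<and> snd (p 1) = 0 \<and>
    (\<forall>t\<in>{0..1}. \<bar>g (p t) - s\<bar> \<le> 3 * l / real n)"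
proof -
  let ?V = "grid_level g l n s"
  let ?R = "grid_adj \<inter> ?V \<times> ?V"
  obtain v w where vw: "v \<in> ?V" "snd v = n" "snd w = 0" "(v, w) \<in> ?R\<^sup>*"
    using grid_chain_crossing[OF g n left right] by blast
  obtain m where m: "m \<le> card ?R" "(v, w) \<in> ?R ^^ m"
    using vw(4) rtrancl_finite_eq_relpow[OF card_grid_adj_le(1)[OF finite_grid_level]] by auto
  then obtain c where c: "c 0 = v" "c m = w" "\<And>i. i < m \<Longrightarrow> (c i, c (Suc i)) \<in> ?R"
    unfolding relpow_fun_conv by auto
  have cV: "c i \<in> ?V" if "i \<le> m" for i
    using that vw(1) c(1) c(3)[of "i - 1"] by (cases i) auto
  have "real m \<le> real (9 * card ?V)"
    using m card_grid_adj_le(2)[OF finite_grid_level, of g l n s] by linarith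
  also have "\<dots> \<le> 9 * (K * real n)" using card by simp
  finally have mK: "real m \<le> 9 * (K * real n)" .
  define f where "f i = (real (fst (c i)) / real n, real (snd (c i)) / real n)" for i
  have fsq: "f i \<in> unit_square" if "i \<le> m" for i
    using cV[OF that] n by (auto simp: f_def unit_square_def grid_level_def divide_simps)
  have fstep: "dist (f i) (f (Suc i)) \<le> 2 / real n" if "i < m" for i
  proof -
    have *: "\<bar>real a / real n - real b / real n\<bar> \<le> 1 / real n" if "\<bar>int a - int b\<bar> \<le> 1" for a b
    proof -
      have "\<bar>real a - real b\<bar> \<le> 1" using that by linarith
      then have "\<bar>real a - real b\<bar> / real n \<le> 1 / real n" by (intro divide_right_mono) auto
      then show ?thesis using n by (simp add: diff_divide_distrib[symmetric] abs_divide)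
    qed
    have "dist (f i) (f (Suc i)) \<le> \<bar>real (fst (c i)) / real n - real (fst (c (Suc i))) / real n\<bar>
        + \<bar>real (snd (c i)) / real n - real (snd (c (Suc i))) / real n\<bar>"
      unfolding f_def dist_Pair_Pair dist_real_def by (rule order_trans[OF sqrt_sum_squares_le_sum_abs]) simp
    also have "\<dots> \<le> 1 / real n + 1 / real n"
      using c(3)[OF that] by (intro add_mono *) (auto simp: grid_adj_def)
    finally show ?thesis by simp
  qed
  obtain q where q: "(2 / real n)-lipschitz_on {0..real m} q" "q ` {0..real m} \<subseteq> unit_square"
    "\<And>i. i \<le> m \<Longrightarrow> q (real i) = f i"
    using lipschitz_interpolation[OF convex_unit_square, of "2 / real n" m f] fsq fstep by auto
  have l: "l \<ge> 0" using lipschitz_on_nonneg[OF g] .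
  have q_lev: "\<bar>g (q x) - s\<bar> \<le> 3 * l / real n" if x: "x \<in> {0..real m}" for x
  proof -
    define i where "i = nat \<lfloor>x\<rfloor>"
    have i: "real i \<le> x" "x \<le> real i + 1" "i \<le> m"
      using x by (auto simp: i_def le_nat_iff floor_le_iff nat_le_iff)
    then have im: "real i \<in> {0..real m}" by auto
    have fi: "\<bar>g (f i) - s\<bar> \<le> l / real n"
      using cV[OF i(3)] by (simp add: grid_level_def f_def)
    have "\<bar>g (q x) - g (q (real i))\<bar> \<le> l * dist (q x) (q (real i))"
      using lipschitz_onD[OF g, of "q x" "q (real i)"] subsetD[OF q(2) imageI[OF x]] subsetD[OF q(2) imageI[OF im]]
      by (simp add: dist_real_def)
    also have "\<dots> \<le> l * (2 / real n * dist x (real i))"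
      using l lipschitz_onD[OF q(1) x im] by (intro mult_left_mono) auto
    also have "\<dots> \<le> l * (2 / real n * 1)"
      using l i by (intro mult_left_mono) (auto simp: dist_real_def)
    finally show ?thesis using fi q(3)[OF i(3)] by simp
  qed
  define p where "p t = q (real m * t)" for t
  have sc: "real m * t \<in> {0..real m}" if "t \<in> {0..1}" for t
    using that mult_left_le[of t "real m"] by simp
  have "(2 / real n * real m)-lipschitz_on {0..1} p"
  proof (rule lipschitz_onI)
    fix t t' :: real assume "t \<in> {0..1}" "t' \<in> {0..1}"
    then have "dist (p t) (p t') \<le> 2 / real n * dist (real m * t) (real m * t')"
      unfolding p_def by (intro lipschitz_onD[OF q(1)] sc)
    also have "dist (real m * t) (real m * t') = real m * dist t t'"
      by (simp add: dist_real_def right_diff_distrib[symmetric] abs_mult)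
    finally show "dist (p t) (p t') \<le> 2 / real n * real m * dist t t'" by simp
  qed simp
  moreover have "2 / real n * real m \<le> 18 * K"
    using mK n by (simp add: divide_simps mult.commute)
  ultimately have "(18 * K)-lipschitz_on {0..1} p" by (rule lipschitz_on_le)
  moreover have "p ` {0..1} \<subseteq> unit_square" using q(2) sc by (auto simp: p_def)
  moreover have "snd (p 0) = 1" "snd (p 1) = 0"
    using q(3)[of 0] q(3)[of m] c vw n by (auto simp: p_def f_def)
  moreover have "\<bar>g (p t) - s\<bar> \<le> 3 * l / real n" if "t \<in> {0..1}" for t
    using q_lev[OF sc[OF that]] by (simp add: p_def)
  ultimately show ?thesis by blast
qed

text \<open>Since \<open>18 * K\<close> does not depend on \<open>n\<close>, the crossing paths are
  equicontinuous. A uniform limit keeps the constant and the heights of the ends, while the level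
  error vanishes.\<close>

lemma lipschitz_path_in_level_set:
  fixes g :: "real \<times> real \<Rightarrow> real"
  assumes g: "l-lipschitz_on unit_square g"
    and left: "\<And>y. y \<in> {0..1} \<Longrightarrow> g (0, y) < s" and right: "\<And>y. y \<in> {0..1} \<Longrightarrow> g (1, y) > s"
    and card: "\<exists>\<^sub>F n in sequentially. real (card (grid_level g l n s)) \<le> K * real n"
  obtains p :: "real \<Rightarrow> real \<times> real" where "(18 * K)-lipschitz_on {0..1} p" "p ` {0..1} \<subseteq> unit_square" "snd (p 0) = 1" "snd (p 1) = 0"
    "\<And>t. t \<in> {0..1} \<Longrightarrow> g (p t) = s"
proof -
  \<comment> \<open>The point count is small frequently, not eventually, so the grid sizes
    \<open>N k\<close> are picked beyond every \<open>k\<close>.\<close>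
  have "\<exists>n>k. real (card (grid_level g l n s)) \<le> K * real n" for k
    using card unfolding frequently_sequentially by (metis Suc_le_lessD)
  then obtain N where N: "\<And>k. N k > k" "\<And>k. real (card (grid_level g l (N k) s)) \<le> K * real (N k)"
    by metis
  have "\<exists>p :: real \<Rightarrow> real \<times> real. (18 * K)-lipschitz_on {0..1} p \<and> p ` {0..1} \<subseteq> unit_square \<and> snd (p 0) = 1 \<and> snd (p 1) = 0 \<and>
    (\<forall>t\<in>{0..1}. \<bar>g (p t) - s\<bar> \<le> 3 * l / real (N k))" for k
    using N[of k] by (intro grid_path_crossing[OF g _ left right]) auto
  then obtain P :: "nat \<Rightarrow> real \<Rightarrow> real \<times> real" where "\<forall>k. (18 * K)-lipschitz_on {0..1} (P k) \<and> P k ` {0..1} \<subseteq> unit_square \<and>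
    snd (P k 0) = 1 \<and> snd (P k 1) = 0 \<and> (\<forall>t\<in>{0..1}. \<bar>g (P k t) - s\<bar> \<le> 3 * l / real (N k))"
    using choice[of "\<lambda>k (p :: real \<Rightarrow> real \<times> real). (18 * K)-lipschitz_on {0..1} p \<and> p ` {0..1} \<subseteq> unit_square \<and>
      snd (p 0) = 1 \<and> snd (p 1) = 0 \<and> (\<forall>t\<in>{0..1}. \<bar>g (p t) - s\<bar> \<le> 3 * l / real (N k))"] by blast
  then have P: "\<And>k. (18 * K)-lipschitz_on {0..1} (P k)" "\<And>k. P k ` {0..1} \<subseteq> unit_square"
    "\<And>k. snd (P k 0) = 1" "\<And>k. snd (P k 1) = 0"
    "\<And>k t. t \<in> {0..1} \<Longrightarrow> \<bar>g (P k t) - s\<bar> \<le> 3 * l / real (N k)"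
    by auto
  obtain M where M: "\<And>z. z \<in> unit_square \<Longrightarrow> norm z \<le> M"
    using compact_imp_bounded[OF compact_unit_square] by (auto simp: bounded_iff)
  have K: "18 * K \<ge> 0" using lipschitz_on_nonneg[OF P(1)] .
  obtain p r where r: "strict_mono (r :: nat \<Rightarrow> nat)"
    and lim: "\<And>e. 0 < e \<Longrightarrow> \<exists>n0. \<forall>n x. n \<ge> n0 \<and> x \<in> {0..1} \<longrightarrow> norm (P (r n) x - p x) < e"
  proof (rule Arzela_Ascoli[of "{0..1::real}" P M])
    show "norm (P n x) \<le> M" if "x \<in> {0..1}" for n x using P(2) M that by blast
    show "\<exists>d>0. \<forall>n y. y \<in> {0..1} \<and> norm (x - y) < d \<longrightarrow> norm (P n x - P n y) < e"
      if x: "x \<in> {0..1}" and "0 < e" for x e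
    \<comment> \<open>The added 1 keeps the denominator positive when \<open>K = 0\<close>.\<close>
    proof (intro exI[of _ "e / (18 * K + 1)"] conjI allI impI)
      show "0 < e / (18 * K + 1)" using K \<open>0 < e\<close> by simp
      fix n y assume y: "y \<in> {0..1} \<and> norm (x - y) < e / (18 * K + 1)"
      have "norm (P n x - P n y) \<le> 18 * K * norm (x - y)"
        using lipschitz_on_normD[OF P(1) x] y by blast
      also have "\<dots> \<le> (18 * K + 1) * norm (x - y)" by (intro mult_right_mono) auto
      also have "\<dots> < e" using y K by (simp add: pos_less_divide_eq mult.commute)
      finally show "norm (P n x - P n y) < e" .
    qed
  qed auto
  have tend: "(\<lambda>n. P (r n) t) \<longlonglongrightarrow> p t" if "t \<in> {0..1}" for t
    unfolding LIMSEQ_iff using lim that by meson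
  show ?thesis
  proof
    show "(18 * K)-lipschitz_on {0..1} p"
    proof (rule lipschitz_onI[OF _ K])
      fix x y :: real assume xy: "x \<in> {0..1}" "y \<in> {0..1}"
      show "dist (p x) (p y) \<le> 18 * K * dist x y"
        by (rule LIMSEQ_le_const2[OF tendsto_dist[OF tend[OF xy(1)] tend[OF xy(2)]]])
          (use lipschitz_onD[OF P(1) xy] in blast)
    qed
    show sq: "p ` {0..1} \<subseteq> unit_square"
      using closed_sequentially[OF compact_imp_closed[OF compact_unit_square] _ tend] P(2) by blast
    show "snd (p 0) = 1" "snd (p 1) = 0"
      using tendsto_snd[OF tend[of 0]] tendsto_snd[OF tend[of 1]] P(3,4) by (auto simp: LIMSEQ_const_iff)
    fix t :: real assume t: "t \<in> {0..1}"
    have "(\<lambda>n. g (P (r n) t)) \<longlonglongrightarrow> g (p t)"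
    proof (rule continuous_on_tendsto_compose[OF lipschitz_on_continuous_on[OF g] tend[OF t]])
      show "p t \<in> unit_square" using sq t by blast
      show "\<forall>\<^sub>F n in sequentially. P (r n) t \<in> unit_square"
        using P(2) t by (intro always_eventually allI) blast
    qed
    moreover have "(\<lambda>n. g (P (r n) t)) \<longlonglongrightarrow> s"
    proof (rule LIM_zero_cancel, rule Lim_null_comparison)
      show "\<forall>\<^sub>F n in sequentially. norm (g (P (r n) t) - s) \<le> 3 * l / real (N (r n))"
        using P(5)[OF t] by (intro always_eventually allI) simp
      have "\<forall>\<^sub>F n in sequentially. n \<le> N (r n)"
      proof (intro always_eventually allI)
        fix n
        show "n \<le> N (r n)" using N(1)[of "r n"] strict_mono_imp_increasing[OF r, of n] by linarith
      qed
      then have "filterlim (\<lambda>n. N (r n)) at_top sequentially"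
        by (rule filterlim_at_top_mono[OF filterlim_ident])
      then have "filterlim (\<lambda>n. real (N (r n))) at_top sequentially"
        by (rule filterlim_compose[OF filterlim_real_sequentially])
      then show "(\<lambda>n. 3 * l / real (N (r n))) \<longlonglongrightarrow> 0"
        by (rule real_tendsto_divide_at_top[OF tendsto_const])
    qed
    ultimately show "g (p t) = s" by (rule LIMSEQ_unique)
  qed
qed

section \<open>Length\<close>

lemma length_on_leI:
  assumes "\<And>n t. (\<And>i. i \<le> n \<Longrightarrow> t i \<in> {a..b}) \<Longrightarrow> (\<And>i. i < n \<Longrightarrow> t i \<le> t (Suc i)) \<Longrightarrow>
    (\<Sum>i<n. ennreal (dist (\<gamma> (t i)) (\<gamma> (t (Suc i))))) \<le> X"
  shows "length_on a b \<gamma> \<le> X"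
  unfolding length_on_def by (rule SUP_least) (use assms in auto)

lemma sum_le_length_on:
  assumes "\<And>i. i \<le> n \<Longrightarrow> t i \<in> {a..b}" "\<And>i. i < n \<Longrightarrow> t i \<le> t (Suc i)"
  shows "(\<Sum>i<n. ennreal (dist (\<gamma> (t i)) (\<gamma> (t (Suc i))))) \<le> length_on a b \<gamma>"
  unfolding length_on_def by (rule SUP_upper2[of "(n, t)"]) (use assms in auto)

lemma dist_le_length_on:
  assumes "s \<in> {a..b}" "t \<in> {a..b}"
  shows "ennreal (dist (\<gamma> s) (\<gamma> t)) \<le> length_on a b \<gamma>"
proof -
  have *: "ennreal (dist (\<gamma> s) (\<gamma> t)) \<le> length_on a b \<gamma>" if "s \<le> t" "s \<in> {a..b}" "t \<in> {a..b}" for s t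
    using sum_le_length_on[of 1 "\<lambda>i. if i = 0 then s else t" a b \<gamma>] that by auto
  show ?thesis using *[of s t] *[of t s] assms by (cases "s \<le> t") (auto simp: dist_commute)
qed

lemma length_on_lipschitz:
  assumes L: "L-lipschitz_on {a..b} \<gamma>" and "a \<le> b"
  shows "length_on a b \<gamma> \<le> ennreal (L * (b - a))"
proof (rule length_on_leI)
  fix n and t :: "nat \<Rightarrow> real"
  assume t: "\<And>i. i \<le> n \<Longrightarrow> t i \<in> {a..b}" "\<And>i. i < n \<Longrightarrow> t i \<le> t (Suc i)"
  have "(\<Sum>i<n. dist (\<gamma> (t i)) (\<gamma> (t (Suc i)))) \<le> (\<Sum>i<n. L * (t (Suc i) - t i))"
  proof (rule sum_mono)
    fix i assume "i \<in> {..<n}"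
    then show "dist (\<gamma> (t i)) (\<gamma> (t (Suc i))) \<le> L * (t (Suc i) - t i)"
      using lipschitz_onD[OF L t(1)[of i] t(1)[of "Suc i"]] t(2)[of i] by (simp add: dist_real_def)
  qed
  also have "\<dots> = L * (t n - t 0)"
    by (simp add: sum_distrib_left[symmetric] sum_lessThan_telescope)
  also have "\<dots> \<le> L * (b - a)"
    using t(1)[of 0] t(1)[of n] lipschitz_on_nonneg[OF L] by (intro mult_left_mono) auto
  finally show "(\<Sum>i<n. ennreal (dist (\<gamma> (t i)) (\<gamma> (t (Suc i))))) \<le> ennreal (L * (b - a))"
    by (subst sum_ennreal) (auto intro: ennreal_leI)
qed

lemma length_on_cong:
  assumes "\<And>t. t \<in> {a..b} \<Longrightarrow> \<gamma> t = \<gamma>' t"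
  shows "length_on a b \<gamma> = length_on a b \<gamma>'"
proof -
  have *: "length_on a b \<gamma> \<le> length_on a b \<gamma>'" if eq: "\<And>t. t \<in> {a..b} \<Longrightarrow> \<gamma> t = \<gamma>' t" for \<gamma> \<gamma>' :: "real \<Rightarrow> 'a"
  proof (rule length_on_leI)
    fix n and t :: "nat \<Rightarrow> real"
    assume t: "\<And>i. i \<le> n \<Longrightarrow> t i \<in> {a..b}" "\<And>i. i < n \<Longrightarrow> t i \<le> t (Suc i)"
    have "(\<Sum>i<n. ennreal (dist (\<gamma> (t i)) (\<gamma> (t (Suc i))))) = (\<Sum>i<n. ennreal (dist (\<gamma>' (t i)) (\<gamma>' (t (Suc i)))))"
      using t(1) eq by (intro sum.cong) auto
    then show "(\<Sum>i<n. ennreal (dist (\<gamma> (t i)) (\<gamma> (t (Suc i))))) \<le> length_on a b \<gamma>'"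
      using sum_le_length_on[of n t a b \<gamma>'] t by simp
  qed
  show ?thesis using assms by (intro antisym *) auto
qed

lemma length_on_comp_mono:
  assumes "\<And>t. t \<in> {a..b} \<Longrightarrow> f t \<in> {c..d}" "mono_on {a..b} f"
  shows "length_on a b (\<gamma> \<circ> f) \<le> length_on c d \<gamma>"
proof (rule length_on_leI)
  fix n and t :: "nat \<Rightarrow> real"
  assume t: "\<And>i. i \<le> n \<Longrightarrow> t i \<in> {a..b}" "\<And>i. i < n \<Longrightarrow> t i \<le> t (Suc i)"
  show "(\<Sum>i<n. ennreal (dist ((\<gamma> \<circ> f) (t i)) ((\<gamma> \<circ> f) (t (Suc i))))) \<le> length_on c d \<gamma>"
    using sum_le_length_on[of n "\<lambda>i. f (t i)" c d \<gamma>] t assms by (auto simp: monotone_on_def)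
qed

lemma length_on_comp_antimono:
  assumes "\<And>t. t \<in> {a..b} \<Longrightarrow> f t \<in> {c..d}" "antimono_on {a..b} f"
  shows "length_on a b (\<gamma> \<circ> f) \<le> length_on c d \<gamma>"
proof (rule length_on_leI)
  fix n and t :: "nat \<Rightarrow> real"
  assume t: "\<And>i. i \<le> n \<Longrightarrow> t i \<in> {a..b}" "\<And>i. i < n \<Longrightarrow> t i \<le> t (Suc i)"
  \<comment> \<open>The partition is read backwards, so that the antimonotone \<open>f\<close> makes
    it increasing.\<close>
  define t' where "t' i = f (t (n - i))" for i
  have "(\<Sum>i<n. ennreal (dist (\<gamma> (f (t i))) (\<gamma> (f (t (Suc i)))))) =
      (\<Sum>i<n. ennreal (dist (\<gamma> (f (t (n - Suc i)))) (\<gamma> (f (t (Suc (n - Suc i)))))))"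
    by (rule sum.nat_diff_reindex[symmetric])
  also have "\<dots> = (\<Sum>i<n. ennreal (dist (\<gamma> (t' i)) (\<gamma> (t' (Suc i)))))"
    by (intro sum.cong) (auto simp: t'_def Suc_diff_Suc dist_commute)
  also have "\<dots> \<le> length_on c d \<gamma>"
  proof (rule sum_le_length_on)
    fix i assume "i < n"
    then have "t (n - Suc i) \<le> t (n - i)" using t(2)[of "n - Suc i"] by (simp add: Suc_diff_Suc)
    then show "t' i \<le> t' (Suc i)"
      using assms(2) t(1)[of "n - i"] t(1)[of "n - Suc i"] by (auto simp: t'_def monotone_on_def)
  qed (use t assms in \<open>auto simp: t'_def\<close>)
  finally show "(\<Sum>i<n. ennreal (dist ((\<gamma> \<circ> f) (t i)) ((\<gamma> \<circ> f) (t (Suc i))))) \<le> length_on c d \<gamma>"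
    by simp
qed

lemma length_on_le_add:
  assumes "a \<le> b" "b \<le> c"
  shows "length_on a c \<gamma> \<le> length_on a b \<gamma> + length_on b c \<gamma>"
proof (rule length_on_leI)
  fix n and t :: "nat \<Rightarrow> real"
  assume t: "\<And>i. i \<le> n \<Longrightarrow> t i \<in> {a..c}" "\<And>i. i < n \<Longrightarrow> t i \<le> t (Suc i)"
  \<comment> \<open>Instead of inserting \<open>b\<close> into the partition, its points are clamped
    to either side of \<open>b\<close>. A step crossing \<open>b\<close> is split by the triangle
    inequality at \<open>\<gamma> b\<close>; any other step has length 0 on one side.\<close>
  define u v where "u i = min (t i) b" and "v i = max (t i) b" for i
  have "(\<Sum>i<n. ennreal (dist (\<gamma> (t i)) (\<gamma> (t (Suc i))))) \<le>
     (\<Sum>i<n. ennreal (dist (\<gamma> (u i)) (\<gamma> (u (Suc i)))) + ennreal (dist (\<gamma> (v i)) (\<gamma> (v (Suc i)))))"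
  proof (rule sum_mono)
    fix i assume "i \<in> {..<n}"
    then have "t i \<le> t (Suc i)" using t by auto
    then have "dist (\<gamma> (t i)) (\<gamma> (t (Suc i))) \<le> dist (\<gamma> (u i)) (\<gamma> (u (Suc i))) + dist (\<gamma> (v i)) (\<gamma> (v (Suc i)))"
      using dist_triangle[of "\<gamma> (t i)" "\<gamma> (t (Suc i))" "\<gamma> b"]
      by (cases "t i \<le> b"; cases "t (Suc i) \<le> b") (auto simp: u_def v_def min_def max_def)
    then show "ennreal (dist (\<gamma> (t i)) (\<gamma> (t (Suc i)))) \<le>
        ennreal (dist (\<gamma> (u i)) (\<gamma> (u (Suc i)))) + ennreal (dist (\<gamma> (v i)) (\<gamma> (v (Suc i))))"
      using ennreal_leI by (fastforce simp flip: ennreal_plus)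
  qed
  also have "\<dots> = (\<Sum>i<n. ennreal (dist (\<gamma> (u i)) (\<gamma> (u (Suc i))))) + (\<Sum>i<n. ennreal (dist (\<gamma> (v i)) (\<gamma> (v (Suc i)))))"
    by (rule sum.distrib)
  also have "\<dots> \<le> length_on a b \<gamma> + length_on b c \<gamma>"
  proof (intro add_mono sum_le_length_on)
    fix i
    show "u i \<in> {a..b}" if "i \<le> n" using t(1)[OF that] assms by (auto simp: u_def)
    show "v i \<in> {b..c}" if "i \<le> n" using t(1)[OF that] assms by (auto simp: v_def)
    show "u i \<le> u (Suc i)" "v i \<le> v (Suc i)" if "i < n" using t(2)[OF that] by (auto simp: u_def v_def)
  qed
  finally show "(\<Sum>i<n. ennreal (dist (\<gamma> (t i)) (\<gamma> (t (Suc i))))) \<le> length_on a b \<gamma> + length_on b c \<gamma>" .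
qed

lemma add_le_length_on:
  assumes "a \<le> b" "b \<le> c"
  shows "length_on a b \<gamma> + length_on b c \<gamma> \<le> length_on a c \<gamma>"
proof -
  define P where "P a b = {(n, t :: nat \<Rightarrow> real). (\<forall>i\<le>n. t i \<in> {a..b}) \<and> (\<forall>i<n. t i \<le> t (Suc i))}" for a b
  define S where "S = (\<lambda>(n, t). \<Sum>i<n. ennreal (dist (\<gamma> (t i)) (\<gamma> (t (Suc i)))))"
  have len: "length_on a b \<gamma> = Sup (S ` P a b)" for a b
    unfolding length_on_def P_def S_def by (simp add: case_prod_beta)
  have ne: "P a b \<noteq> {}" if "a \<le> b" for a b
    using that by (auto simp: P_def intro!: exI[of _ "\<lambda>_. a"])
  have cat: "S p + S q \<le> length_on a c \<gamma>" if "p \<in> P a b" "q \<in> P b c" for p q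
  proof -
    obtain n t m u where p: "p = (n, t)" and q: "q = (m, u)" by fastforce
    have t: "\<And>i. i \<le> n \<Longrightarrow> t i \<in> {a..b}" "\<And>i. i < n \<Longrightarrow> t i \<le> t (Suc i)"
      and u: "\<And>i. i \<le> m \<Longrightarrow> u i \<in> {b..c}" "\<And>i. i < m \<Longrightarrow> u i \<le> u (Suc i)"
      using that by (auto simp: P_def p q)
    \<comment> \<open>The two partitions in sequence. Position \<open>n\<close> is the junction from
      \<open>t n\<close> to \<open>u 0\<close>; its term \<open>D n\<close> is dropped, hence the
      shift by \<open>Suc n\<close>.\<close>
    define w where "w i = (if i \<le> n then t i else u (i - Suc n))" for i
    define D where "D i = ennreal (dist (\<gamma> (w i)) (\<gamma> (w (Suc i))))" for i
    have "S p = (\<Sum>i<n. D i)"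
      by (auto simp: S_def p D_def w_def intro!: sum.cong)
    moreover have "S q = (\<Sum>i<m. D (i + Suc n))"
      by (auto simp: S_def q D_def w_def intro!: sum.cong)
    moreover have "(\<Sum>i<m. D (i + Suc n)) = (\<Sum>i=Suc n..<m + Suc n. D i)"
      using sum.shift_bounds_nat_ivl[of D 0 "Suc n" m] by (simp add: lessThan_atLeast0)
    moreover have "(\<Sum>i<n. D i) + (\<Sum>i=Suc n..<m + Suc n. D i) = (\<Sum>i\<in>{..<n} \<union> {Suc n..<m + Suc n}. D i)"
      by (subst sum.union_disjoint) auto
    moreover have "\<dots> \<le> (\<Sum>i<m + Suc n. D i)"
      by (intro sum_mono2) auto
    moreover have "\<dots> \<le> length_on a c \<gamma>"
      unfolding D_def
    proof (rule sum_le_length_on)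
      show "w i \<in> {a..c}" if "i \<le> m + Suc n" for i
      proof (cases "i \<le> n")
        case False
        then have "i - Suc n \<le> m" using that by simp
        then show ?thesis using u(1)[of "i - Suc n"] assms False by (simp add: w_def)
      qed (use t(1)[of i] assms in \<open>simp add: w_def\<close>)
      show "w i \<le> w (Suc i)" if "i < m + Suc n" for i
      proof -
        consider "i < n" | "i = n" | "i > n" by linarith
        then show ?thesis
          using t(1)[of i] t(2)[of i] u(1)[of 0] u(2)[of "i - Suc n"] that
          by cases (auto simp: w_def Suc_diff_Suc)
      qed
    qed
    ultimately show ?thesis by simp
  qed
  have "S p + length_on b c \<gamma> \<le> length_on a c \<gamma>" if "p \<in> P a b" for p
    unfolding len[of b c] using cat[OF that]
    by (subst ennreal_SUP_add_right[OF ne[OF assms(2)]]) (auto intro: SUP_least)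
  then show ?thesis
    unfolding len[of a b]
    by (subst ennreal_SUP_add_left[OF ne[OF assms(1)], symmetric]) (auto intro: SUP_least)
qed

section \<open>The pseudo-metric of a Lipschitz map on the square\<close>

lemma dist_le_d1: "dist a b \<le> d1 a b"
  unfolding d1_def dist_prod_def dist_real_def
  by (rule order_trans[OF sqrt_sum_squares_le_sum_abs]) simp

lemma d1_le_dist: "d1 a b \<le> 2 * dist a b"
  using dist_fst_le[of a b] dist_snd_le[of a b] by (simp add: d1_def dist_real_def)

text \<open>\<open>d1\<close> and the Euclidean distance agree up to a factor 2, so the two notions
  of Lipschitz map differ only in the constant, and \<open>lipschitz_on\<close> becomes
  available.\<close>

lemma lipschitz_map_square_iff: "lipschitz_map_square H \<longleftrightarrow> (\<exists>L. L-lipschitz_on unit_square H)"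
proof
  assume "lipschitz_map_square H"
  then obtain L where L: "L \<ge> 0" "\<And>a a'. a \<in> unit_square \<Longrightarrow> a' \<in> unit_square \<Longrightarrow> dist (H a) (H a') \<le> L * d1 a a'"
    unfolding lipschitz_map_square_def by blast
  have "(L * 2)-lipschitz_on unit_square H"
  proof (rule lipschitz_onI)
    fix a a' assume "a \<in> unit_square" "a' \<in> unit_square"
    then show "dist (H a) (H a') \<le> L * 2 * dist a a'"
      using L(2)[of a a'] mult_left_mono[OF d1_le_dist[of a a'] L(1)] by linarith
  qed (use L in auto)
  then show "\<exists>L. L-lipschitz_on unit_square H" by blast
next
  assume "\<exists>L. L-lipschitz_on unit_square H"
  then obtain L where L: "L-lipschitz_on unit_square H" by blast
  have "dist (H a) (H a') \<le> L * d1 a a'" if "a \<in> unit_square" "a' \<in> unit_square" for a a'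
    using lipschitz_onD[OF L that] mult_left_mono[OF dist_le_d1[of a a'] lipschitz_on_nonneg[OF L]] by linarith
  then show "lipschitz_map_square H"
    unfolding lipschitz_map_square_def using lipschitz_on_nonneg[OF L] by blast
qed

lemma lipschitz_path_square_iff:
  "lipschitz_path_square a a' c \<longleftrightarrow>
     c ` {0..1} \<subseteq> unit_square \<and> c 0 = a \<and> c 1 = a' \<and> lipschitz_path c"
proof -
  have "(\<exists>L\<ge>0. \<forall>t \<in> {0..1}. \<forall>t' \<in> {0..1}. d1 (c t) (c t') \<le> L * \<bar>t - t'\<bar>) \<longleftrightarrow> lipschitz_path c"
  proof
    assume "\<exists>L\<ge>0. \<forall>t \<in> {0..1}. \<forall>t' \<in> {0..1}. d1 (c t) (c t') \<le> L * \<bar>t - t'\<bar>"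
    then obtain L where "L \<ge> 0" "\<And>t t'. t \<in> {0..1} \<Longrightarrow> t' \<in> {0..1} \<Longrightarrow> d1 (c t) (c t') \<le> L * \<bar>t - t'\<bar>"
      by blast
    then show "lipschitz_path c"
      unfolding lipschitz_path_def using order_trans[OF dist_le_d1]
      by (intro exI[of _ L] lipschitz_onI) (auto simp: dist_real_def)
  next
    assume "lipschitz_path c"
    then obtain L where L: "L-lipschitz_on {0..1} c" unfolding lipschitz_path_def by blast
    have "d1 (c t) (c t') \<le> 2 * L * \<bar>t - t'\<bar>" if "t \<in> {0..1}" "t' \<in> {0..1}" for t t'
      using lipschitz_onD[OF L that] d1_le_dist[of "c t" "c t'"] by (simp add: dist_real_def)
    then show "\<exists>L\<ge>0. \<forall>t \<in> {0..1}. \<forall>t' \<in> {0..1}. d1 (c t) (c t') \<le> L * \<bar>t - t'\<bar>"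
      using lipschitz_on_nonneg[OF L] by (intro exI[of _ "2 * L"]) auto
  qed
  then show ?thesis unfolding lipschitz_path_square_def by blast
qed

lemma lipschitz_path_square_in: "lipschitz_path_square a a' c \<Longrightarrow> a \<in> unit_square \<and> a' \<in> unit_square"
  unfolding lipschitz_path_square_def by force

lemma lipschitz_path_comp_square:
  assumes "lipschitz_map_square H" "lipschitz_path_square a a' c"
  shows "lipschitz_path (H \<circ> c)"
proof -
  obtain L K where "L-lipschitz_on unit_square H" "K-lipschitz_on {0..1} c" "c ` {0..1} \<subseteq> unit_square"
    using assms unfolding lipschitz_map_square_iff lipschitz_path_square_iff lipschitz_path_def by blast
  then show ?thesis
    unfolding lipschitz_path_def by (meson lipschitz_on_compose lipschitz_on_subset)
qed

text \<open>\<open>v < u\<close> is allowed: the path is then run backwards, so one statement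
  supplies both subpaths and reversals.\<close>

lemma lipschitz_path_square_affine:
  assumes c: "lipschitz_path_square a a' c" and uv: "u \<in> {0..1}" "v \<in> {0..1}"
  shows "lipschitz_path_square (c u) (c v) (\<lambda>t. c (u + t * (v - u)))"
proof -
  have in01: "u + t * (v - u) \<in> {0..1}" if "t \<in> {0..1}" for t
    using convexD_alt[of "{0..1::real}" u v t] that uv by (simp add: algebra_simps)
  obtain L where L: "L-lipschitz_on {0..1} c"
    using c unfolding lipschitz_path_square_iff lipschitz_path_def by blast
  have "(L * \<bar>v - u\<bar>)-lipschitz_on {0..1} (\<lambda>t. c (u + t * (v - u)))"
  proof (rule lipschitz_on_compose2[OF _ lipschitz_on_subset[OF L]])
    show "\<bar>v - u\<bar>-lipschitz_on {0..1} (\<lambda>t. u + t * (v - u))"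
      by (intro lipschitz_onI) (auto simp: dist_real_def left_diff_distrib[symmetric] abs_mult)
  qed (use in01 in auto)
  moreover have "(\<lambda>t. c (u + t * (v - u))) ` {0..1} \<subseteq> unit_square"
    using c in01 unfolding lipschitz_path_square_iff by blast
  ultimately show ?thesis
    unfolding lipschitz_path_square_iff lipschitz_path_def by auto
qed

lemma lipschitz_path_square_segment:
  assumes "a \<in> unit_square" "a' \<in> unit_square"
  shows "lipschitz_path_square a a' (\<lambda>t. (1 - t) *\<^sub>R a + t *\<^sub>R a')"
proof -
  have "(norm (a' - a))-lipschitz_on {0..1} (\<lambda>t. (1 - t) *\<^sub>R a + t *\<^sub>R a')"
  proof (rule lipschitz_onI)
    fix t t' :: real
    have "((1 - t) *\<^sub>R a + t *\<^sub>R a') - ((1 - t') *\<^sub>R a + t' *\<^sub>R a') = (t - t') *\<^sub>R (a' - a)"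
      by (simp add: algebra_simps)
    then show "dist ((1 - t) *\<^sub>R a + t *\<^sub>R a') ((1 - t') *\<^sub>R a + t' *\<^sub>R a') \<le> norm (a' - a) * dist t t'"
      by (simp add: dist_norm)
  qed simp
  moreover have "(\<lambda>t. (1 - t) *\<^sub>R a + t *\<^sub>R a') ` {0..1} \<subseteq> unit_square"
    using assms by (auto intro!: convexD[OF convex_unit_square])
  ultimately show ?thesis
    unfolding lipschitz_path_square_iff lipschitz_path_def by auto
qed

lemma lipschitz_path_square_join:
  assumes "lipschitz_path_square a b c" "lipschitz_path_square b d c'"
  shows "lipschitz_path_square a d (c +++ c')"
    and "(c +++ c') ` {0..1} = c ` {0..1} \<union> c' ` {0..1}"
proof -
  obtain L L' where L: "L-lipschitz_on {0..1} c" "L'-lipschitz_on {0..1} c'"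
    using assms unfolding lipschitz_path_square_iff lipschitz_path_def by blast
  have eq: "c 0 = a" "c 1 = b" "c' 0 = b" "c' 1 = d" and sq: "c ` {0..1} \<subseteq> unit_square" "c' ` {0..1} \<subseteq> unit_square"
    using assms unfolding lipschitz_path_square_iff by auto
  show im: "(c +++ c') ` {0..1} = c ` {0..1} \<union> c' ` {0..1}"
    using path_image_join[of c c'] eq by (simp add: path_image_def pathstart_def pathfinish_def)
  have "(max (L * 2) (L' * 2))-lipschitz_on {0..1} (c +++ c')"
    unfolding joinpaths_def
  proof (rule lipschitz_on_concat_max)
    have [simp]: "2-lipschitz_on X (\<lambda>x::real. 2 * x)" "2-lipschitz_on X (\<lambda>x::real. 2 * x - 1)" for X
    proof -
      have "\<bar>2 * x - 2 * y\<bar> = 2 * \<bar>x - y\<bar>" for x y :: real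
        using abs_mult[of 2 "x - y"] by (simp add: right_diff_distrib)
      then show "2-lipschitz_on X (\<lambda>x::real. 2 * x)" "2-lipschitz_on X (\<lambda>x::real. 2 * x - 1)"
        by (simp_all add: lipschitz_on_def dist_real_def)
    qed
    show "(L * 2)-lipschitz_on {0..1/2} (\<lambda>x. c (2 * x))"
      by (rule lipschitz_on_compose2[OF _ lipschitz_on_subset[OF L(1)]]) auto
    show "(L' * 2)-lipschitz_on {1/2..1} (\<lambda>x. c' (2 * x - 1))"
      by (rule lipschitz_on_compose2[OF _ lipschitz_on_subset[OF L(2)]]) auto
  qed (simp add: eq)
  then show "lipschitz_path_square a d (c +++ c')"
    unfolding lipschitz_path_square_iff lipschitz_path_def im using sq eq by (auto simp: joinpaths_def)
qed

lemma length_join_le: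
  assumes "c 1 = c' 0"
  shows "path_length (H \<circ> (c +++ c')) \<le> path_length (H \<circ> c) + path_length (H \<circ> c')"
proof -
  have "path_length (H \<circ> (c +++ c')) \<le> length_on 0 (1/2) (H \<circ> (c +++ c')) + length_on (1/2) 1 (H \<circ> (c +++ c'))"
    by (rule length_on_le_add) auto
  moreover have "length_on 0 (1/2) (H \<circ> (c +++ c')) \<le> path_length (H \<circ> c)"
  proof -
    have "length_on 0 (1/2) (H \<circ> (c +++ c')) = length_on 0 (1/2) ((H \<circ> c) \<circ> (\<lambda>x. 2 * x))"
      by (rule length_on_cong) (auto simp: joinpaths_def)
    also have "\<dots> \<le> path_length (H \<circ> c)"
      by (rule length_on_comp_mono) (auto simp: monotone_on_def)
    finally show ?thesis .
  qed
  moreover have "length_on (1/2) 1 (H \<circ> (c +++ c')) \<le> path_length (H \<circ> c')"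
  proof -
    have "length_on (1/2) 1 (H \<circ> (c +++ c')) = length_on (1/2) 1 ((H \<circ> c') \<circ> (\<lambda>x. 2 * x - 1))"
    proof (rule length_on_cong)
      fix t :: real assume t: "t \<in> {1/2..1}"
      show "(H \<circ> (c +++ c')) t = (H \<circ> c' \<circ> (\<lambda>x. 2 * x - 1)) t"
      proof (cases "t = 1/2")
        case True
        show ?thesis unfolding True using assms by (simp add: joinpaths_def)
      qed (use t in \<open>simp add: joinpaths_def\<close>)
    qed
    also have "\<dots> \<le> path_length (H \<circ> c')"
      by (rule length_on_comp_mono) (auto simp: monotone_on_def)
    finally show ?thesis .
  qed
  ultimately show ?thesis by (meson add_mono order_trans)
qed

text \<open>Returning to \<open>ennreal\<close> lets later bounds be read off the infimum directly.
  Finiteness matters, since \<open>enn2real\<close> would turn an infinite infimum into 0.\<close>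

lemma ennreal_d_H:
  assumes "lipschitz_map_square H" "a \<in> unit_square" "a' \<in> unit_square"
  shows "ennreal (d_H H a a') = (INF c \<in> {c. lipschitz_path_square a a' c}. path_length (H \<circ> c))"
proof -
  let ?c = "\<lambda>t. (1 - t) *\<^sub>R a + t *\<^sub>R a'"
  have c: "lipschitz_path_square a a' ?c" using lipschitz_path_square_segment assms by blast
  obtain L where "L-lipschitz_on {0..1} (H \<circ> ?c)"
    using lipschitz_path_comp_square[OF assms(1) c] unfolding lipschitz_path_def by blast
  then have "path_length (H \<circ> ?c) \<le> ennreal (L * (1 - 0))" by (rule length_on_lipschitz) simp
  then have "path_length (H \<circ> ?c) < \<infinity>" by (rule le_less_trans) simp
  moreover have "(INF c \<in> {c. lipschitz_path_square a a' c}. path_length (H \<circ> c)) \<le> path_length (H \<circ> ?c)"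
    using c by (intro INF_lower) auto
  ultimately have "(INF c \<in> {c. lipschitz_path_square a a' c}. path_length (H \<circ> c)) < \<infinity>"
    by (rule le_less_trans[rotated])
  then show ?thesis unfolding d_H_def by (simp add: less_top)
qed

lemma d_H_nonneg: "d_H H a a' \<ge> 0"
  by (simp add: d_H_def)

lemma d_H_le_length:
  assumes "lipschitz_map_square H" "lipschitz_path_square a a' c"
  shows "ennreal (d_H H a a') \<le> path_length (H \<circ> c)"
  using assms lipschitz_path_square_in[OF assms(2)] by (subst ennreal_d_H) (auto intro: INF_lower)

lemma d_H_less:
  assumes "lipschitz_map_square H" "a \<in> unit_square" "a' \<in> unit_square" "d_H H a a' < r"
  obtains c where "lipschitz_path_square a a' c" "path_length (H \<circ> c) < ennreal r"
proof -
  have "ennreal (d_H H a a') < ennreal r"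
    using assms(4) d_H_nonneg[of H a a'] by (simp add: ennreal_less_iff)
  then show ?thesis using that ennreal_d_H[OF assms(1-3)] by (auto simp: INF_less_iff)
qed

lemma dist_le_d_H:
  assumes "lipschitz_map_square H" "a \<in> unit_square" "a' \<in> unit_square"
  shows "dist (H a) (H a') \<le> d_H H a a'"
proof -
  have "ennreal (dist (H a) (H a')) \<le> ennreal (d_H H a a')"
    unfolding ennreal_d_H[OF assms]
  proof (rule INF_greatest)
    fix c assume "c \<in> {c. lipschitz_path_square a a' c}"
    then have "c 0 = a" "c 1 = a'" by (auto simp: lipschitz_path_square_def)
    then show "ennreal (dist (H a) (H a')) \<le> path_length (H \<circ> c)"
      using dist_le_length_on[of 0 0 1 1 "H \<circ> c"] by simp
  qed
  then show ?thesis by (simp add: d_H_nonneg ennreal_le_iff)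
qed

lemma d_H_eq_0_if_constant:
  assumes "lipschitz_map_square H" "lipschitz_path_square a a' c" "\<And>t. t \<in> {0..1} \<Longrightarrow> H (c t) = P"
  shows "d_H H a a' = 0"
proof -
  have "path_length (H \<circ> c) = length_on 0 1 (\<lambda>_. P)"
    using assms(3) by (intro length_on_cong) auto
  also have "\<dots> \<le> ennreal (0 * (1 - 0))"
    by (rule length_on_lipschitz) (auto intro: lipschitz_intros)
  finally have "ennreal (d_H H a a') \<le> 0"
    using d_H_le_length[OF assms(1,2)] by (simp add: order_trans)
  then show ?thesis using d_H_nonneg[of H a a'] by simp
qed

lemma d_H_refl:
  assumes "lipschitz_map_square H" "a \<in> unit_square"
  shows "d_H H a a = 0"
  by (rule d_H_eq_0_if_constant[OF assms(1) lipschitz_path_square_segment[OF assms(2,2)], of "H a"])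
    (simp add: scaleR_left_distrib[symmetric])

lemma d_H_commute:
  assumes "lipschitz_map_square H" "a \<in> unit_square" "a' \<in> unit_square"
  shows "d_H H a a' = d_H H a' a"
proof -
  have *: "d_H H a' a \<le> d_H H a a'" if aa: "a \<in> unit_square" "a' \<in> unit_square" for a a'
  proof -
    have "ennreal (d_H H a' a) \<le> ennreal (d_H H a a')"
      unfolding ennreal_d_H[OF assms(1) aa]
    proof (rule INF_greatest)
      fix c assume "c \<in> {c. lipschitz_path_square a a' c}"
      then have c: "lipschitz_path_square a a' c" by simp
      then have "lipschitz_path_square a' a (\<lambda>t. c (1 + t * (0 - 1)))"
        using lipschitz_path_square_affine[OF c, of 1 0] unfolding lipschitz_path_square_def by simp
      then have "ennreal (d_H H a' a) \<le> path_length (H \<circ> (\<lambda>t. c (1 + t * (0 - 1))))"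
        by (rule d_H_le_length[OF assms(1)])
      also have "\<dots> = path_length ((H \<circ> c) \<circ> (\<lambda>t. 1 + t * (0 - 1)))" by (simp add: comp_def)
      also have "\<dots> \<le> path_length (H \<circ> c)"
        by (rule length_on_comp_antimono) (auto simp: monotone_on_def)
      finally show "ennreal (d_H H a' a) \<le> path_length (H \<circ> c)" .
    qed
    then show ?thesis by (simp add: d_H_nonneg ennreal_le_iff)
  qed
  show ?thesis using *[OF assms(2,3)] *[OF assms(3,2)] by simp
qed

lemma d_H_triangle:
  assumes H: "lipschitz_map_square H" and sq: "a \<in> unit_square" "b \<in> unit_square" "e \<in> unit_square"
  shows "d_H H a e \<le> d_H H a b + d_H H b e"
proof (rule field_le_epsilon)
  fix \<epsilon> :: real assume "\<epsilon> > 0"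
  obtain c where c: "lipschitz_path_square a b c" "path_length (H \<circ> c) < ennreal (d_H H a b + \<epsilon>/2)"
    using d_H_less[OF H sq(1,2)] \<open>\<epsilon> > 0\<close> by (metis half_gt_zero less_add_same_cancel1)
  obtain c' where c': "lipschitz_path_square b e c'" "path_length (H \<circ> c') < ennreal (d_H H b e + \<epsilon>/2)"
    using d_H_less[OF H sq(2,3)] \<open>\<epsilon> > 0\<close> by (metis half_gt_zero less_add_same_cancel1)
  have "ennreal (d_H H a e) \<le> path_length (H \<circ> (c +++ c'))"
    using d_H_le_length[OF H] lipschitz_path_square_join(1)[OF c(1) c'(1)] by blast
  also have "\<dots> \<le> path_length (H \<circ> c) + path_length (H \<circ> c')"
    using c(1) c'(1) by (intro length_join_le) (auto simp: lipschitz_path_square_def)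
  also have "\<dots> \<le> ennreal (d_H H a b + \<epsilon>/2) + ennreal (d_H H b e + \<epsilon>/2)"
    using c(2) c'(2) by (intro add_mono) auto
  also have "\<dots> = ennreal (d_H H a b + d_H H b e + \<epsilon>)"
    using d_H_nonneg[of H a b] d_H_nonneg[of H b e] \<open>\<epsilon> > 0\<close> by (simp flip: ennreal_plus)
  finally show "d_H H a e \<le> d_H H a b + d_H H b e + \<epsilon>"
    using d_H_nonneg[of H a b] d_H_nonneg[of H b e] \<open>\<epsilon> > 0\<close> by (subst (asm) ennreal_le_iff) auto
qed

lemma d_H_along_path:
  assumes H: "lipschitz_map_square H" and c: "lipschitz_path_square a a' c" and uv: "0 \<le> u" "u \<le> v" "v \<le> 1"
  shows "ennreal (d_H H (c u) (c v)) \<le> length_on u v (H \<circ> c)"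
proof -
  have "ennreal (d_H H (c u) (c v)) \<le> path_length (H \<circ> (\<lambda>t. c (u + t * (v - u))))"
    using uv by (intro d_H_le_length[OF H] lipschitz_path_square_affine[OF c]) auto
  also have "\<dots> = path_length ((H \<circ> c) \<circ> (\<lambda>t. u + t * (v - u)))" by (simp add: comp_def)
  also have "\<dots> \<le> length_on u v (H \<circ> c)"
  proof (rule length_on_comp_mono)
    fix t :: real assume "t \<in> {0..1}"
    then show "u + t * (v - u) \<in> {u..v}"
      using uv mult_left_le_one_le[of "v - u" t] by auto
  qed (use uv in \<open>auto simp: monotone_on_def intro: mult_right_mono\<close>)
  finally show ?thesis .
qed

text \<open>Cutting the path at \<open>u\<close> bounds each distance by the length of one part. For
  a nearly shortest path this limits how far a point of it can be from one end once its distance to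
  the other end is known.\<close>

lemma d_H_add_le_length:
  assumes H: "lipschitz_map_square H" and c: "lipschitz_path_square a a' c" and u: "u \<in> {0..1}"
    and len: "path_length (H \<circ> c) \<le> ennreal r" and r: "r \<ge> 0"
  shows "d_H H a (c u) + d_H H (c u) a' \<le> r"
proof -
  have e: "c 0 = a" "c 1 = a'" using c by (auto simp: lipschitz_path_square_def)
  have "ennreal (d_H H a (c u) + d_H H (c u) a') = ennreal (d_H H (c 0) (c u)) + ennreal (d_H H (c u) (c 1))"
    by (simp add: e d_H_nonneg flip: ennreal_plus)
  also have "\<dots> \<le> length_on 0 u (H \<circ> c) + length_on u 1 (H \<circ> c)"
    using u by (intro add_mono d_H_along_path[OF H c]) auto
  also have "\<dots> \<le> path_length (H \<circ> c)"
    using u by (intro add_le_length_on) auto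
  finally show ?thesis using len r by (meson ennreal_le_iff order_trans)
qed

text \<open>Every path competing for \<open>H \<circ> G\<close> is pushed by \<open>G\<close> to one
  competing for \<open>H\<close> with the same image curve. Zero distances found in an auxiliary
  square thereby descend to the original one.\<close>

lemma d_H_comp_le:
  assumes H: "lipschitz_map_square H" and G: "K-lipschitz_on unit_square G" "G ` unit_square \<subseteq> unit_square"
    and sq: "a \<in> unit_square" "b \<in> unit_square"
  shows "lipschitz_map_square (H \<circ> G)" "d_H H (G a) (G b) \<le> d_H (H \<circ> G) a b"
proof -
  obtain L where L: "L-lipschitz_on unit_square H" using H unfolding lipschitz_map_square_iff by blast
  then show HG: "lipschitz_map_square (H \<circ> G)"
    unfolding lipschitz_map_square_iff by (meson G lipschitz_on_compose lipschitz_on_subset)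
  have "ennreal (d_H H (G a) (G b)) \<le> ennreal (d_H (H \<circ> G) a b)"
    unfolding ennreal_d_H[OF HG sq]
  proof (rule INF_greatest)
    fix c assume "c \<in> {c. lipschitz_path_square a b c}"
    then have c: "lipschitz_path_square a b c" by simp
    then have "c ` {0..1} \<subseteq> unit_square" by (simp add: lipschitz_path_square_def)
    then have "(G \<circ> c) ` {0..1} \<subseteq> unit_square" using G(2) by auto
    moreover have "lipschitz_path (G \<circ> c)"
      using c G(1) unfolding lipschitz_path_square_iff lipschitz_path_def
      by (meson lipschitz_on_compose lipschitz_on_subset)
    ultimately have "lipschitz_path_square (G a) (G b) (G \<circ> c)"
      using c unfolding lipschitz_path_square_iff by simp
    then show "ennreal (d_H H (G a) (G b)) \<le> path_length (H \<circ> G \<circ> c)"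
      using d_H_le_length[OF H] by (simp add: comp_assoc)
  qed
  then show "d_H H (G a) (G b) \<le> d_H (H \<circ> G) a b" by (simp add: d_H_nonneg ennreal_le_iff)
qed

section \<open>Squares spanned between two paths\<close>

definition interpolate :: "(real \<Rightarrow> real \<times> real) \<Rightarrow> (real \<Rightarrow> real \<times> real) \<Rightarrow> real \<times> real \<Rightarrow> real \<times> real" where
  "interpolate \<beta> \<alpha> z = (1 - snd z) *\<^sub>R \<beta> (fst z) + snd z *\<^sub>R \<alpha> (fst z)"

lemma interpolate_square:
  assumes "lipschitz_path_square a b \<beta>" "lipschitz_path_square a' b' \<alpha>"
  shows "interpolate \<beta> \<alpha> ` unit_square \<subseteq> unit_square" "\<exists>K. K-lipschitz_on unit_square (interpolate \<beta> \<alpha>)"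
proof -
  obtain L L' where L: "L-lipschitz_on {0..1} \<beta>" "L'-lipschitz_on {0..1} \<alpha>"
    and sq: "\<beta> ` {0..1} \<subseteq> unit_square" "\<alpha> ` {0..1} \<subseteq> unit_square"
    using assms unfolding lipschitz_path_square_iff lipschitz_path_def by blast
  have L0: "L \<ge> 0" "L' \<ge> 0" using L lipschitz_on_nonneg by auto
  show "interpolate \<beta> \<alpha> ` unit_square \<subseteq> unit_square"
    using sq by (auto simp: interpolate_def unit_square_def[symmetric] intro!: convexD[OF convex_unit_square])
      (auto simp: unit_square_def)
  \<comment> \<open>\<open>L\<close> and \<open>L'\<close> control the horizontal direction; 2 is
    the \<open>d1\<close>-diameter of the square and bounds the vertical speed
    \<open>norm (\<alpha> x' - \<beta> x')\<close>.\<close>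
  have "(L + L' + 2)-lipschitz_on unit_square (interpolate \<beta> \<alpha>)"
  proof (rule lipschitz_onI)
    fix z w assume zw: "z \<in> unit_square" "w \<in> unit_square"
    obtain x y x' y' where e: "z = (x, y)" "w = (x', y')" by fastforce
    have in01: "x \<in> {0..1}" "y \<in> {0..1}" "x' \<in> {0..1}" "y' \<in> {0..1}"
      using zw by (auto simp: e unit_square_def)
    have dx: "dist x x' \<le> dist z w" and dy: "\<bar>y - y'\<bar> \<le> dist z w"
      using dist_fst_le[of z w] dist_snd_le[of z w] by (auto simp: e dist_real_def)
    have "norm (\<beta> x - \<beta> x') \<le> L * dist x x'" "norm (\<alpha> x - \<alpha> x') \<le> L' * dist x x'"
      using lipschitz_on_normD[OF L(1)] lipschitz_on_normD[OF L(2)] in01 by (auto simp: dist_norm)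
    then have n1: "norm (\<beta> x - \<beta> x') \<le> L * dist z w" "norm (\<alpha> x - \<alpha> x') \<le> L' * dist z w"
      using mult_left_mono[OF dx L0(1)] mult_left_mono[OF dx L0(2)] by linarith+
    have "\<alpha> x' \<in> unit_square" "\<beta> x' \<in> unit_square" using sq in01 by auto
    then have "d1 (\<alpha> x') (\<beta> x') \<le> 2" by (auto simp: d1_def unit_square_def mem_Times_iff)
    then have n2: "norm (\<alpha> x' - \<beta> x') \<le> 2" using dist_le_d1[of "\<alpha> x'" "\<beta> x'"] by (simp add: dist_norm)
    have "interpolate \<beta> \<alpha> z - interpolate \<beta> \<alpha> w =
        (1 - y) *\<^sub>R (\<beta> x - \<beta> x') + y *\<^sub>R (\<alpha> x - \<alpha> x') + (y - y') *\<^sub>R (\<alpha> x' - \<beta> x')"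
      by (simp add: interpolate_def e algebra_simps)
    then have "dist (interpolate \<beta> \<alpha> z) (interpolate \<beta> \<alpha> w) \<le>
        norm ((1 - y) *\<^sub>R (\<beta> x - \<beta> x')) + norm (y *\<^sub>R (\<alpha> x - \<alpha> x')) + norm ((y - y') *\<^sub>R (\<alpha> x' - \<beta> x'))"
      unfolding dist_norm by (metis norm_triangle_ineq norm_triangle_mono order_refl)
    also have "\<dots> = (1 - y) * norm (\<beta> x - \<beta> x') + y * norm (\<alpha> x - \<alpha> x') + \<bar>y - y'\<bar> * norm (\<alpha> x' - \<beta> x')"
      using in01 by simp
    also have "\<dots> \<le> 1 * (L * dist z w) + 1 * (L' * dist z w) + dist z w * 2"
      using in01 n1 n2 dy L0 by (intro add_mono mult_mono) auto
    finally show "dist (interpolate \<beta> \<alpha> z) (interpolate \<beta> \<alpha> w) \<le> (L + L' + 2) * dist z w"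
      by (simp add: algebra_simps)
  qed (use L0 in auto)
  then show "\<exists>K. K-lipschitz_on unit_square (interpolate \<beta> \<alpha>)" by blast
qed

lemma AE_lborel_in_interval:
  fixes a b :: real
  assumes "AE s in lborel. R s" "a < b"
  obtains s where "a < s" "s < b" "R s"
proof -
  obtain N where N: "{s \<in> space lborel. \<not> R s} \<subseteq> N" "emeasure lborel N = 0" "N \<in> sets lborel"
    using AE_E[OF assms(1)] by metis
  have "\<not> {a<..<b} \<subseteq> N"
  proof
    assume "{a<..<b} \<subseteq> N"
    then have "emeasure lborel {a<..<b} \<le> emeasure lborel N" using N(3) by (rule emeasure_mono)
    then show False using N(2) \<open>a < b\<close> by simp
  qed
  then show ?thesis using N(1) that by fastforce
qed

text \<open>\<open>g\<close> is 0 on the left and \<open>dist P Q\<close> on the right, so every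
  level strictly between separates the sides. At a level good for both almost-everywhere statements
  the crossing path has a connected image inside a fibre, hence a constant one. \<open>x'\<close> is
  interior because \<open>g\<close> takes the value \<open>s\<close> at the top end of the
  path.\<close>

lemma pinched_square_top_meets_bottom:
  fixes F :: "real \<times> real \<Rightarrow> 'a::metric_space"
  assumes F: "lipschitz_map_square F" and null: "hausdorff_measure 2 (F ` unit_square) = 0"
    and left: "\<And>y. y \<in> {0..1} \<Longrightarrow> F (0, y) = P" and right: "\<And>y. y \<in> {0..1} \<Longrightarrow> F (1, y) = Q"
    and "P \<noteq> Q"
  obtains x x' where "x \<in> {0..1}" "0 < x'" "x' < 1" "d_H F (x, 0) (x', 1) = 0"
proof -
  obtain L where L: "L-lipschitz_on unit_square F" using F unfolding lipschitz_map_square_iff by blast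
  define g where "g z = dist P (F z)" for z
  have h: "1-lipschitz_on X (dist P)" for X
    using abs_dist_diff_le[of _ P] by (intro lipschitz_onI) (auto simp: dist_real_def dist_commute)
  have g: "L-lipschitz_on unit_square g"
    using lipschitz_on_compose2[OF L h] by (simp add: g_def)
  define trivial_fibre where "trivial_fibre s \<longleftrightarrow>
    (\<forall>C x y. connected C \<and> C \<subseteq> F ` unit_square \<inter> dist P -` {s} \<and> x \<in> C \<and> y \<in> C \<longrightarrow> x = y)" for s
  define few_points where "few_points s \<longleftrightarrow> (\<exists>K. \<exists>\<^sub>F n in sequentially. real (card (grid_level g L n s)) \<le> K * real n)" for s
  have ae: "AE s in lborel. trivial_fibre s \<and> few_points s"
    using AE_connected_fibre_trivial[OF null h] AE_few_grid_points[OF lipschitz_on_nonneg[OF L], of g]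
    by eventually_elim (simp add: trivial_fibre_def few_points_def)
  obtain s where s: "0 < s" "s < dist P Q" "trivial_fibre s" "few_points s"
    using AE_lborel_in_interval[OF ae, of 0 "dist P Q"] \<open>P \<noteq> Q\<close> by (metis zero_less_dist_iff)
  have const: "x = y" if "connected C" "C \<subseteq> F ` unit_square \<inter> dist P -` {s}" "x \<in> C" "y \<in> C" for C x y
    using s(3) that unfolding trivial_fibre_def by blast
  obtain K where K: "\<exists>\<^sub>F n in sequentially. real (card (grid_level g L n s)) \<le> K * real n"
    using s(4) unfolding few_points_def by blast
  obtain p :: "real \<Rightarrow> real \<times> real" where p: "(18 * K)-lipschitz_on {0..1} p" "p ` {0..1} \<subseteq> unit_square"
      "snd (p 0) = 1" "snd (p 1) = 0" "\<And>t. t \<in> {0..1} \<Longrightarrow> g (p t) = s"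
    using lipschitz_path_in_level_set[OF g _ _ K] s left right by (auto simp: g_def)
  have path: "lipschitz_path_square (p 0) (p 1) p"
    using p unfolding lipschitz_path_square_iff lipschitz_path_def by blast
  have "connected ((F \<circ> p) ` {0..1})"
    using lipschitz_path_comp_square[OF F path]
    by (auto simp: lipschitz_path_def intro!: connected_continuous_image lipschitz_on_continuous_on)
  moreover have "(F \<circ> p) ` {0..1} \<subseteq> F ` unit_square \<inter> dist P -` {s}"
    using p(2,5) by (auto simp: g_def)
  ultimately have "F (p t) = F (p 0)" if "t \<in> {0..1}" for t
    using that by (intro const[of "(F \<circ> p) ` {0..1}"]) (auto intro!: image_eqI[of _ "F \<circ> p"])
  then have "d_H F (p 0) (p 1) = 0"
    by (rule d_H_eq_0_if_constant[OF F path])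
  moreover have sq: "p 0 \<in> unit_square" "p 1 \<in> unit_square" using p(2) by auto
  ultimately have "d_H F (p 1) (p 0) = 0" using d_H_commute[OF F] by metis
  moreover have "p 1 = (fst (p 1), 0)" "p 0 = (fst (p 0), 1)" using p(3,4) by (metis prod.collapse)+
  ultimately have zero: "d_H F (fst (p 1), 0) (fst (p 0), 1) = 0" by metis
  have "g (fst (p 0), 1) = s" using p(5)[of 0] p(3) by (metis atLeastAtMost_iff order_refl prod.collapse zero_le_one)
  then have "fst (p 0) \<noteq> 0" "fst (p 0) \<noteq> 1" using left[of 1] right[of 1] s by (auto simp: g_def)
  moreover have "fst (p 0) \<in> {0..1}" "fst (p 1) \<in> {0..1}" using sq by (auto simp: unit_square_def mem_Times_iff)
  ultimately show ?thesis using zero that[of "fst (p 1)" "fst (p 0)"] by auto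
qed

section \<open>Homotopies ending in a shortest path\<close>

text \<open>The homotopies are stacked at double vertical speed. Transitivity is called for because
  the minimizer is shortest in the class of another path, while pushing to the top edge yields
  homotopies to the minimizer itself.\<close>

lemma homotopic_rel_endpoints_trans:
  assumes "homotopic_rel_endpoints \<alpha> \<beta>" "homotopic_rel_endpoints \<beta> \<delta>"
  shows "homotopic_rel_endpoints \<alpha> \<delta>"
proof -
  obtain F G where F: "lipschitz_homotopy \<alpha> \<beta> F" and G: "lipschitz_homotopy \<beta> \<delta> G"
    and ends: "\<alpha> 0 = \<beta> 0" "\<alpha> 1 = \<beta> 1" "\<beta> 0 = \<delta> 0" "\<beta> 1 = \<delta> 1"
    using assms unfolding homotopic_rel_endpoints_def by blast
  obtain K where K: "K \<ge> 0" "\<And>a a'. a \<in> unit_square \<Longrightarrow> a' \<in> unit_square \<Longrightarrow> dist (F a) (F a') \<le> K * d1 a a'"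
    using F unfolding lipschitz_homotopy_def lipschitz_map_square_def by blast
  obtain L where L: "L \<ge> 0" "\<And>a a'. a \<in> unit_square \<Longrightarrow> a' \<in> unit_square \<Longrightarrow> dist (G a) (G a') \<le> L * d1 a a'"
    using G unfolding lipschitz_homotopy_def lipschitz_map_square_def by blast
  define J where "J a = (if snd a \<le> 1/2 then F (fst a, 2 * snd a) else G (fst a, 2 * snd a - 1))" for a
  have mid: "F (t, 1) = G (t, 0)" if "t \<in> {0..1}" for t
    using F G that unfolding lipschitz_homotopy_def by metis
  have J1: "J a = F (fst a, 2 * snd a)" "(fst a, 2 * snd a) \<in> unit_square" if "a \<in> unit_square" "snd a \<le> 1/2" for a
    using that by (auto simp: J_def unit_square_def)
  have J2: "J a = G (fst a, 2 * snd a - 1)" "(fst a, 2 * snd a - 1) \<in> unit_square" if "a \<in> unit_square" "snd a \<ge> 1/2" for a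
  proof -
    show "(fst a, 2 * snd a - 1) \<in> unit_square" using that by (auto simp: unit_square_def)
    show "J a = G (fst a, 2 * snd a - 1)"
    proof (cases "snd a = 1/2")
      case True
      have "fst a \<in> {0..1}" using that by (auto simp: unit_square_def)
      then show ?thesis using mid by (simp add: J_def True)
    qed (use that in \<open>simp add: J_def\<close>)
  qed
  have d1_scale: "d1 (x, 2 * y + c) (x', 2 * y' + c) \<le> 2 * d1 (x, y) (x', y')" for x y x' y' c
    using abs_mult[of 2 "y - y'"] by (simp add: d1_def right_diff_distrib)
  \<comment> \<open>The 2 is the vertical speed, \<open>K + L\<close> a common bound for both
    halves.\<close>
  let ?C = "2 * (K + L)"
  have low: "dist (J a) (J a') \<le> ?C * d1 a a'" if "a \<in> unit_square" "a' \<in> unit_square" "snd a \<le> 1/2" "snd a' \<le> 1/2" for a a'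
  proof -
    have "dist (J a) (J a') \<le> K * d1 (fst a, 2 * snd a) (fst a', 2 * snd a')"
      using K(2) J1 that by metis
    also have "\<dots> \<le> K * (2 * d1 a a')"
      using d1_scale[of "fst a" "snd a" 0 "fst a'" "snd a'"] K by (intro mult_left_mono) auto
    also have "\<dots> \<le> ?C * d1 a a'"
      using L by (auto simp: algebra_simps d1_def intro!: add_nonneg_nonneg)
    finally show ?thesis .
  qed
  have high: "dist (J a) (J a') \<le> ?C * d1 a a'" if "a \<in> unit_square" "a' \<in> unit_square" "snd a \<ge> 1/2" "snd a' \<ge> 1/2" for a a'
  proof -
    have "dist (J a) (J a') \<le> L * d1 (fst a, 2 * snd a - 1) (fst a', 2 * snd a' - 1)"
      using L(2) J2 that by metis
    also have "\<dots> \<le> L * (2 * d1 a a')"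
      using d1_scale[of "fst a" "snd a" "-1" "fst a'" "snd a'"] L by (intro mult_left_mono) auto
    also have "\<dots> \<le> ?C * d1 a a'"
      using K by (auto simp: algebra_simps d1_def intro!: add_nonneg_nonneg)
    finally show ?thesis .
  qed
  have mixed: "dist (J a) (J a') \<le> ?C * d1 a a'" if "a \<in> unit_square" "a' \<in> unit_square" "snd a \<le> 1/2" "snd a' \<ge> 1/2" for a a'
  proof -
    \<comment> \<open>The auxiliary point on the seam lies straight above \<open>a\<close>; in the
      \<open>d1\<close> metric the detour through it costs nothing, so the constant
      survives.\<close>
    let ?m = "(fst a, 1/2 :: real)"
    have m: "?m \<in> unit_square" using that by (auto simp: unit_square_def)
    have "dist (J a) (J a') \<le> dist (J a) (J ?m) + dist (J ?m) (J a')" by (rule dist_triangle)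
    also have "\<dots> \<le> ?C * d1 a ?m + ?C * d1 ?m a'"
      using low[OF that(1) m] high[OF m that(2)] that by (intro add_mono) auto
    also have "\<dots> = ?C * (d1 a ?m + d1 ?m a')" by (simp add: algebra_simps)
    also have "d1 a ?m + d1 ?m a' = d1 a a'" using that by (simp add: d1_def)
    finally show ?thesis .
  qed
  have "dist (J a) (J a') \<le> ?C * d1 a a'" if "a \<in> unit_square" "a' \<in> unit_square" for a a'
  proof -
    have "d1 a a' = d1 a' a" by (simp add: d1_def abs_minus_commute)
    then show ?thesis
      using low[OF that] high[OF that] mixed[OF that] mixed[OF that(2,1)] by (metis dist_commute linear)
  qed
  then have "lipschitz_map_square J"
    unfolding lipschitz_map_square_def using K L by (intro exI[of _ ?C]) auto
  moreover have "J (t, 0) = \<alpha> t \<and> J (t, 1) = \<delta> t" if "t \<in> {0..1}" for t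
    using F G that unfolding lipschitz_homotopy_def by (simp add: J_def)
  moreover have "J (0, s) = \<alpha> 0 \<and> J (1, s) = \<alpha> 1" if "s \<in> {0..1}" for s
  proof (cases "s \<le> 1/2")
    case True
    then have "2 * s \<in> {0..1}" using that by simp
    then show ?thesis using F True unfolding lipschitz_homotopy_def by (simp add: J_def)
  next
    case False
    then have "2 * s - 1 \<in> {0..1}" using that by simp
    then show ?thesis using G False ends unfolding lipschitz_homotopy_def by (simp add: J_def)
  qed
  ultimately have "lipschitz_homotopy \<alpha> \<delta> J"
    unfolding lipschitz_homotopy_def by blast
  then show ?thesis
    using assms unfolding homotopic_rel_endpoints_def by auto
qed

lemma lipschitz_path_square_horizontal:
  assumes "y \<in> {0..1}"
  shows "lipschitz_path_square (0, y) (1, y) (\<lambda>t. (t, y))"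
proof -
  have "(\<lambda>t. (1 - t) *\<^sub>R (0, y) + t *\<^sub>R (1, y)) = (\<lambda>t. (t, y))"
    by (auto simp: algebra_simps)
  then show ?thesis
    using lipschitz_path_square_segment[of "(0, y)" "(1, y)"] assms by (simp add: unit_square_def)
qed

text \<open>The straight-line homotopy from \<open>c\<close> to the top edge stays in the convex
  square and fixes both top corners, so composing it with \<open>H\<close> keeps the
  endpoints.\<close>

lemma homotopic_push_to_top:
  assumes H: "lipschitz_homotopy \<gamma> \<gamma>' H" and c: "lipschitz_path_square (0, 1) (1, 1) c"
    and \<gamma>': "lipschitz_path \<gamma>'"
  shows "homotopic_rel_endpoints (H \<circ> c) \<gamma>'"
proof -
  let ?G = "interpolate c (\<lambda>t. (t, 1))"
  have top: "lipschitz_path_square (0, 1) (1, 1) (\<lambda>t. (t, 1))"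
    by (rule lipschitz_path_square_horizontal) simp
  have lip: "lipschitz_map_square H" and Htop: "\<And>t. t \<in> {0..1} \<Longrightarrow> H (t, 1) = \<gamma>' t"
    using H unfolding lipschitz_homotopy_def by auto
  have ends: "c 0 = (0, 1)" "c 1 = (1, 1)" using c by (auto simp: lipschitz_path_square_def)
  obtain K where "K-lipschitz_on unit_square ?G"
    using interpolate_square(2)[OF c top] by blast
  then have "lipschitz_map_square (H \<circ> ?G)"
    using d_H_comp_le(1)[OF lip _ interpolate_square(1)[OF c top], of K "(0,0)" "(0,0)"]
    by (simp add: unit_square_def)
  then have "lipschitz_homotopy (H \<circ> c) \<gamma>' (H \<circ> ?G)"
    unfolding lipschitz_homotopy_def using ends Htop
    by (auto simp: interpolate_def algebra_simps simp flip: zero_prod_def)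
  then show ?thesis
    unfolding homotopic_rel_endpoints_def
    using lipschitz_path_comp_square[OF lip c] \<gamma>' Htop ends by auto
qed

section \<open>The quotient by the pseudo-metric\<close>

lemma tree_psi_iff:
  "b \<in> tree_psi H a \<longleftrightarrow> a \<in> unit_square \<and> b \<in> unit_square \<and> d_H H a b = 0"
  by (auto simp: tree_psi_def tree_rel_def)

lemma d_H_eq_of_zero:
  assumes "lipschitz_map_square H" "a \<in> unit_square" "b \<in> unit_square" "e \<in> unit_square" "d_H H a b = 0"
  shows "d_H H a e = d_H H b e"
  using d_H_triangle[OF assms(1), of a b e] d_H_triangle[OF assms(1), of b a e] d_H_commute[OF assms(1), of a b] assms
  by simp

lemma tree_dist_psi:
  assumes "lipschitz_map_square H" "a \<in> unit_square" "b \<in> unit_square"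
  shows "tree_dist H (tree_psi H a) (tree_psi H b) = d_H H a b"
proof -
  have "d_H H a' b' = d_H H a b" if "a' \<in> tree_psi H a" "b' \<in> tree_psi H b" for a' b'
    using that assms d_H_eq_of_zero[OF assms(1), of a a' b'] d_H_eq_of_zero[OF assms(1), of b b' a]
      d_H_commute[OF assms(1)] by (metis tree_psi_iff)
  moreover have "a \<in> tree_psi H a" "b \<in> tree_psi H b"
    using assms d_H_refl[OF assms(1,2)] d_H_refl[OF assms(1,3)] by (simp_all add: tree_psi_iff)
  ultimately have "(\<lambda>(a, a'). d_H H a a') ` (tree_psi H a \<times> tree_psi H b) = {d_H H a b}"
    by force
  then show ?thesis by (simp add: tree_dist_def)
qed

lemma tree_phi_psi:
  assumes "lipschitz_map_square H" "a \<in> unit_square"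
  shows "tree_phi H (tree_psi H a) = H a"
proof -
  have "H b = H a" if "b \<in> tree_psi H a" for b
    using dist_le_d_H[OF assms(1), of a b] that by (auto simp: tree_psi_iff)
  moreover have "a \<in> tree_psi H a" using assms d_H_refl[OF assms] by (simp add: tree_psi_iff)
  ultimately have "H ` tree_psi H a = {H a}" by force
  then show ?thesis by (simp add: tree_phi_def)
qed

lemma treeE:
  assumes "X \<in> tree H"
  obtains a where "a \<in> unit_square" "X = tree_psi H a"
  using assms unfolding tree_def tree_psi_def by (auto elim: quotientE)

text \<open>Minimality enters only as \<open>shortest\<close>, a statement about paths in the square
  between the top corners; homotopy classes do not occur inside the locale.\<close>

locale shortest_top_edge =
  fixes \<gamma> \<gamma>_inf :: "real \<Rightarrow> 'a::metric_space" and H :: "real \<times> real \<Rightarrow> 'a"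
  assumes unrect: "purely_2_unrectifiable (UNIV :: 'a set)"
    and hom: "lipschitz_homotopy \<gamma> \<gamma>_inf H"
    and top_lipschitz: "lipschitz_path \<gamma>_inf"
    and arc: "arc_length_parametrized \<gamma>_inf"
    and shortest: "\<And>c. lipschitz_path_square (0, 1) (1, 1) c \<Longrightarrow> path_length \<gamma>_inf \<le> path_length (H \<circ> c)"
begin

lemma lip: "lipschitz_map_square H"
  using hom unfolding lipschitz_homotopy_def by blast

lemma boundary:
  "t \<in> {0..1} \<Longrightarrow> H (t, 0) = \<gamma> t" "t \<in> {0..1} \<Longrightarrow> H (t, 1) = \<gamma>_inf t"
  "s \<in> {0..1} \<Longrightarrow> H (0, s) = \<gamma> 0" "s \<in> {0..1} \<Longrightarrow> H (1, s) = \<gamma> 1"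
  using hom unfolding lipschitz_homotopy_def by auto

definition "len = enn2real (path_length \<gamma>_inf)"

lemma len_nonneg: "len \<ge> 0" by (simp add: len_def)

lemma path_length_top: "path_length \<gamma>_inf = ennreal len"
proof -
  obtain K where "K-lipschitz_on {0..1} \<gamma>_inf" using top_lipschitz unfolding lipschitz_path_def by blast
  then have "path_length \<gamma>_inf \<le> ennreal (K * (1 - 0))" by (rule length_on_lipschitz) simp
  then have "path_length \<gamma>_inf < \<infinity>" by (rule le_less_trans) simp
  then show ?thesis by (simp add: len_def less_top)
qed

lemma length_on_top:
  assumes "0 \<le> t" "t \<le> t'" "t' \<le> 1"
  shows "length_on t t' \<gamma>_inf = ennreal (len * (t' - t))"
  using arc assms len_nonneg unfolding arc_length_parametrized_def
  by (auto simp: path_length_top ennreal_mult)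

lemma d_H_top_le:
  assumes "0 \<le> t" "t \<le> t'" "t' \<le> 1"
  shows "d_H H (t, 1) (t', 1) \<le> len * (t' - t)"
proof -
  have "ennreal (d_H H (t, 1) (t', 1)) \<le> length_on t t' (H \<circ> (\<lambda>t. (t, 1)))"
    using d_H_along_path[OF lip lipschitz_path_square_horizontal[of 1] assms] by simp
  also have "\<dots> = length_on t t' \<gamma>_inf"
    using assms boundary(2) by (intro length_on_cong) auto
  finally show ?thesis
    using assms len_nonneg by (simp add: length_on_top ennreal_le_iff)
qed

lemma len_le_d_H: "len \<le> d_H H (0, 1) (1, 1)"
proof -
  have "ennreal len \<le> ennreal (d_H H (0, 1) (1, 1))"
    by (subst ennreal_d_H[OF lip]) (auto simp: unit_square_def path_length_top[symmetric] intro!: INF_greatest shortest)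
  then show ?thesis by (simp add: d_H_nonneg ennreal_le_iff)
qed

lemma in_square: "x \<in> {0..1} \<Longrightarrow> y \<in> {0..1} \<Longrightarrow> (x, y) \<in> unit_square"
  by (simp add: unit_square_def)

text \<open>Each piece of the top edge has \<open>d_H\<close>-distance at most \<open>len\<close>
  times its parameter length between its ends. By minimality the distances of the three pieces cut
  by \<open>t\<close> and \<open>t'\<close> add up to at least \<open>len\<close>, so every bound is
  attained.\<close>

lemma d_H_top:
  assumes "t \<in> {0..1}" "t' \<in> {0..1}"
  shows "d_H H (t, 1) (t', 1) = len * \<bar>t' - t\<bar>"
proof -
  have *: "d_H H (t, 1) (t', 1) = len * (t' - t)" if "0 \<le> t" "t \<le> t'" "t' \<le> 1" for t t'
  proof -
    have "len \<le> d_H H (0, 1) (t, 1) + d_H H (t, 1) (t', 1) + d_H H (t', 1) (1, 1)"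
      using len_le_d_H d_H_triangle[OF lip, of "(0, 1)" "(t, 1)" "(1, 1)"] d_H_triangle[OF lip, of "(t, 1)" "(t', 1)" "(1, 1)"] that
      by (simp add: in_square)
    moreover have "d_H H (0, 1) (t, 1) \<le> len * t" "d_H H (t', 1) (1, 1) \<le> len * (1 - t')"
      using d_H_top_le[of 0 t] d_H_top_le[of t' 1] that by auto
    moreover have "d_H H (t, 1) (t', 1) \<le> len * (t' - t)" using d_H_top_le that by blast
    ultimately show ?thesis by (simp add: algebra_simps)
  qed
  show ?thesis
    using *[of t t'] *[of t' t] assms d_H_commute[OF lip, of "(t, 1)" "(t', 1)"]
    by (cases "t \<le> t'") (auto simp: in_square)
qed

text \<open>A homotopy rel endpoints is constant along the vertical sides. In the tree, each bottom
  corner is therefore the same point as the top corner above it.\<close>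

lemma d_H_sides:
  assumes "y \<in> {0..1}" "y' \<in> {0..1}"
  shows "d_H H (0, y) (0, y') = 0" "d_H H (1, y) (1, y') = 0"
proof -
  have y: "(1 - t) * y + t * y' \<in> {0..1}" if "t \<in> {0..1}" for t
    using convexD_alt[of "{0..1::real}" y y' t] assms that by simp
  have "d_H H (x, y) (x, y') = 0" if "x \<in> {0..1}" "\<And>s. s \<in> {0..1} \<Longrightarrow> H (x, s) = P" for x P
  proof (rule d_H_eq_0_if_constant[OF lip lipschitz_path_square_segment[OF in_square in_square]])
    fix t :: real assume "t \<in> {0..1}"
    then show "H ((1 - t) *\<^sub>R (x, y) + t *\<^sub>R (x, y')) = P"
      using that(2)[OF y] by (simp add: algebra_simps)
  qed (use assms that in auto)
  then show "d_H H (0, y) (0, y') = 0" "d_H H (1, y) (1, y') = 0"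
    using boundary(3,4) by auto
qed

lemma top_nonconstant:
  assumes "len > 0" "0 \<le> u" "u < v" "v \<le> 1"
  obtains t t' where "u \<le> t" "t < t'" "t' \<le> v" "\<gamma>_inf t \<noteq> \<gamma>_inf t'"
proof -
  have False if "\<And>t. t \<in> {u..v} \<Longrightarrow> \<gamma>_inf t = \<gamma>_inf u"
  proof -
    have "length_on u v \<gamma>_inf = length_on u v (\<lambda>_. \<gamma>_inf u)"
      using that by (rule length_on_cong)
    also have "\<dots> \<le> ennreal (0 * (v - u))"
      using assms by (intro length_on_lipschitz) (auto intro: lipschitz_intros)
    finally show False using assms by (simp add: length_on_top)
  qed
  then obtain t where t: "t \<in> {u..v}" "\<gamma>_inf t \<noteq> \<gamma>_inf u" by blast
  moreover have "t \<noteq> u" using t by auto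
  ultimately show ?thesis using that[of u t] by auto
qed

text \<open>\<open>\<beta>\<close> leaves \<open>(t0, 1)\<close> backwards along the top edge, goes
  down the left side, follows \<open>c\<close>, climbs the right side and returns along the top edge
  to \<open>(t1, 1)\<close>; \<open>\<alpha>\<close> is the piece between. The square spanned by
  them has pinched sides, which yields a zero distance from \<open>\<beta> x\<close> to some
  \<open>(t, 1)\<close> with \<open>t0 < t < t1\<close>. Only a point of \<open>c\<close> can
  achieve that.\<close>

lemma path_meets_top:
  assumes len: "len > 0" and c: "lipschitz_path_square (0, 0) (1, 0) c" and uv: "0 \<le> u" "u < v" "v \<le> 1"
  obtains x t where "x \<in> {0..1}" "u < t" "t < v" "d_H H (c x) (t, 1) = 0"
proof -
  obtain t0 t1 where t01: "u \<le> t0" "t0 < t1" "t1 \<le> v" "\<gamma>_inf t0 \<noteq> \<gamma>_inf t1"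
    using top_nonconstant[OF len uv] by blast
  have t01': "t0 \<in> {0..1}" "t1 \<in> {0..1}" using t01 uv by auto
  have top: "lipschitz_path_square (t, 1) (t', 1) (\<lambda>s. (t + s * (t' - t), 1))" if "t \<in> {0..1}" "t' \<in> {0..1}" for t t'
    using lipschitz_path_square_affine[OF lipschitz_path_square_horizontal[of 1] that] by simp
  have corner: "(0, 0) \<in> unit_square" "(0, 1) \<in> unit_square" "(1, 0) \<in> unit_square" "(1, 1) \<in> unit_square"
    by (auto simp: unit_square_def)
  define p1 where "p1 s = (t0 + s * (0 - t0), 1 :: real)" for s
  define p2 where "p2 s = (1 - s) *\<^sub>R (0 :: real, 1 :: real) + s *\<^sub>R (0, 0)" for s
  define p4 where "p4 s = (1 - s) *\<^sub>R (1 :: real, 0 :: real) + s *\<^sub>R (1, 1)" for s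
  define p5 where "p5 s = (1 + s * (t1 - 1), 1 :: real)" for s
  have p: "lipschitz_path_square (t0, 1) (0, 1) p1" "lipschitz_path_square (0, 1) (0, 0) p2"
    "lipschitz_path_square (1, 0) (1, 1) p4" "lipschitz_path_square (1, 1) (t1, 1) p5"
    unfolding p1_def p2_def p4_def p5_def
    by (rule top lipschitz_path_square_segment corner; use t01' in simp)+
  define \<beta> where "\<beta> = p1 +++ p2 +++ c +++ p4 +++ p5"
  note j1 = lipschitz_path_square_join[OF p(3,4)]
  note j2 = lipschitz_path_square_join[OF c j1(1)]
  note j3 = lipschitz_path_square_join[OF p(2) j2(1)]
  note j4 = lipschitz_path_square_join[OF p(1) j3(1)]
  have \<beta>: "lipschitz_path_square (t0, 1) (t1, 1) \<beta>"
    and im: "\<beta> ` {0..1} = p1 ` {0..1} \<union> (p2 ` {0..1} \<union> (c ` {0..1} \<union> (p4 ` {0..1} \<union> p5 ` {0..1})))"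
    unfolding \<beta>_def using j4 j3(2) j2(2) j1(2) by auto
  define \<alpha> where "\<alpha> s = (t0 + s * (t1 - t0), 1 :: real)" for s
  have \<alpha>: "lipschitz_path_square (t0, 1) (t1, 1) \<alpha>"
    unfolding \<alpha>_def by (rule top[OF t01'])
  let ?G = "interpolate \<beta> \<alpha>"
  obtain K where K: "K-lipschitz_on unit_square ?G" using interpolate_square(2)[OF \<beta> \<alpha>] by blast
  note G = d_H_comp_le[OF lip K interpolate_square(1)[OF \<beta> \<alpha>]]
  have lipG: "lipschitz_map_square (H \<circ> ?G)" using G(1)[OF corner(1,1)] .
  then obtain M where M: "M-lipschitz_on unit_square (H \<circ> ?G)" unfolding lipschitz_map_square_iff by blast
  have "unit_square \<in> sets borel" using compact_unit_square by (simp add: borel_compact)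
  then have null: "hausdorff_measure 2 ((H \<circ> ?G) ` unit_square) = 0"
    using unrect M unfolding purely_2_unrectifiable_def by blast
  have ends: "\<beta> 0 = (t0, 1)" "\<beta> 1 = (t1, 1)" "\<alpha> 0 = (t0, 1)" "\<alpha> 1 = (t1, 1)"
    using \<alpha> \<beta> unfolding lipschitz_path_square_def by auto
  obtain x x' where x: "x \<in> {0..1}" "0 < x'" "x' < 1" "d_H (H \<circ> ?G) (x, 0) (x', 1) = 0"
  proof (rule pinched_square_top_meets_bottom[OF lipG null _ _ t01(4)])
    show "(H \<circ> ?G) (0, y) = \<gamma>_inf t0" "(H \<circ> ?G) (1, y) = \<gamma>_inf t1" for y
      using boundary(2) t01' ends by (auto simp: interpolate_def algebra_simps)
  qed
  have "d_H H (?G (x, 0)) (?G (x', 1)) \<le> 0"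
    using G(2)[of "(x, 0)" "(x', 1)"] x by (simp add: in_square)
  then have zero: "d_H H (\<beta> x) (\<alpha> x') = 0"
    using d_H_nonneg[of H "\<beta> x" "\<alpha> x'"] by (simp add: interpolate_def)
  define t where "t = t0 + x' * (t1 - t0)"
  have "0 < x' * (t1 - t0)" "x' * (t1 - t0) < 1 * (t1 - t0)"
    using x t01 by (auto intro!: mult_strict_right_mono)
  then have t: "t0 < t" "t < t1" by (simp_all add: t_def)
  then have t': "t \<in> {0..1}" using t01' by auto
  have zero: "d_H H (\<beta> x) (t, 1) = 0" using zero by (simp add: \<alpha>_def t_def)
  have top_ne: False if "\<beta> x = (w, 1)" "w \<in> {0..1}" "w \<noteq> t" for w
    using zero d_H_top[OF that(2) t'] that len by simp
  \<comment> \<open>A point of a vertical side is at distance 0 from the corner above it, and that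
    corner is a point of the top edge other than \<open>(t, 1)\<close>.\<close>
  have side_ne: False if "\<beta> x = (w, y)" "w = 0 \<or> w = 1" "y \<in> {0..1}" for w y
  proof -
    have w: "w \<in> {0..1}" "w \<noteq> t" using that(2) t t01' by auto
    have "d_H H (w, 1) (w, y) = 0" using d_H_sides that by auto
    then have "d_H H (w, 1) (t, 1) = 0"
      using d_H_triangle[OF lip, of "(w, 1)" "(w, y)" "(t, 1)"] zero that w t' d_H_nonneg[of H "(w, 1)" "(t, 1)"]
      by (simp add: in_square)
    then show False using d_H_top[OF w(1) t'] w len by simp
  qed
  have "\<beta> x \<in> c ` {0..1}"
  proof -
    have "\<beta> x \<notin> p1 ` {0..1}"
    proof
      assume "\<beta> x \<in> p1 ` {0..1}"
      then obtain s where s: "s \<in> {0..1}" "\<beta> x = (t0 - s * t0, 1)" by (auto simp: p1_def)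
      moreover have "s * t0 \<le> t0" "0 \<le> s * t0" using s t01' mult_left_le_one_le[of t0 s] by auto
      ultimately show False using top_ne[of "t0 - s * t0"] t t01' by auto
    qed
    moreover have "\<beta> x \<notin> p5 ` {0..1}"
    proof
      assume "\<beta> x \<in> p5 ` {0..1}"
      then obtain s where s: "s \<in> {0..1}" "\<beta> x = (1 - s * (1 - t1), 1)" by (auto simp: p5_def algebra_simps)
      moreover have "s * (1 - t1) \<le> 1 - t1" "0 \<le> s * (1 - t1)" using s t01' mult_left_le_one_le[of "1 - t1" s] by auto
      ultimately show False using top_ne[of "1 - s * (1 - t1)"] t t01' by auto
    qed
    moreover have "\<beta> x \<notin> p2 ` {0..1}" "\<beta> x \<notin> p4 ` {0..1}"
      using side_ne by (auto simp: p2_def p4_def)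
    ultimately show ?thesis using im x(1) by blast
  qed
  then obtain z where "z \<in> {0..1}" "\<beta> x = c z" by blast
  then show ?thesis using that[of z t] zero t t01 by auto
qed

section \<open>Identifying geodesic points and the image of the minimizer\<close>

lemma small_interval:
  fixes t e :: real
  assumes "t \<in> {0..1}" "e > 0"
  obtains u v where "0 \<le> u" "u < v" "v \<le> 1" "t - e \<le> u" "v \<le> t + e"
  using that[of "max 0 (t - e)" "min 1 (t + e)"] assms by auto

text \<open>
  A nearly shortest path through \<open>a\<close> meets the top edge near \<open>(t, 1)\<close>; as almost no length is
  left between that meeting point and \<open>a\<close>, the two are close.
\<close>

lemma geodesic_point_near_top:
  assumes len: "len > 0" and a: "a \<in> unit_square" and t: "t \<in> {0..1}"
    and d: "d_H H (0, 0) a = len * t" "d_H H a (1, 0) = len * (1 - t)" and "\<epsilon> > 0"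
  shows "d_H H a (t, 1) \<le> (1 + 2 * len) * \<epsilon>"
proof -
  have corner: "(0, 0) \<in> unit_square" "(1, 0) \<in> unit_square" "(0, 1) \<in> unit_square" "(1, 1) \<in> unit_square"
    by (auto simp: unit_square_def)
  obtain c1 where c1: "lipschitz_path_square (0, 0) a c1" "path_length (H \<circ> c1) < ennreal (len * t + \<epsilon>)"
    using d_H_less[OF lip corner(1) a, of "len * t + \<epsilon>"] d \<open>\<epsilon> > 0\<close> by auto
  obtain c2 where c2: "lipschitz_path_square a (1, 0) c2" "path_length (H \<circ> c2) < ennreal (len * (1 - t) + \<epsilon>)"
    using d_H_less[OF lip a corner(2), of "len * (1 - t) + \<epsilon>"] d \<open>\<epsilon> > 0\<close> by auto
  note j = lipschitz_path_square_join[OF c1(1) c2(1)]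
  obtain u v where uv: "0 \<le> u" "u < v" "v \<le> 1" "t - \<epsilon> \<le> u" "v \<le> t + \<epsilon>"
    using small_interval[OF t \<open>\<epsilon> > 0\<close>] by blast
  obtain x t' where x: "x \<in> {0..1}" "u < t'" "t' < v" "d_H H ((c1 +++ c2) x) (t', 1) = 0"
    using path_meets_top[OF len j(1) uv(1-3)] by blast
  define b where "b = (c1 +++ c2) x"
  have t': "t' \<in> {0..1}" "\<bar>t - t'\<bar> \<le> \<epsilon>" using x uv by auto
  then have ltt: "\<bar>len * t - len * t'\<bar> \<le> len * \<epsilon>"
    using len by (simp add: abs_mult flip: right_diff_distrib)
  have bsq: "b \<in> unit_square" using j(1) x(1) unfolding b_def lipschitz_path_square_def by blast
  have sq': "(t, 1) \<in> unit_square" "(t', 1) \<in> unit_square" using t t' by (auto simp: in_square)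
  have bt': "d_H H b (t', 1) = 0" using x(4) by (simp add: b_def)
  have eq: "d_H H b e = d_H H (t', 1) e" if "e \<in> unit_square" for e
    using d_H_eq_of_zero[OF lip bsq sq'(2) that bt'] .
  \<comment> \<open>\<open>b\<close> is at distance 0 from \<open>(t', 1)\<close> and the left
    corners are identified, so the distance is one along the top edge.\<close>
  have b0: "d_H H (0, 0) b = len * t'"
  proof -
    have "d_H H (0, 0) b = d_H H b (0, 0)" using d_H_commute[OF lip corner(1) bsq] .
    also have "\<dots> = d_H H (t', 1) (0, 0)" using eq corner by blast
    also have "\<dots> = d_H H (0, 0) (t', 1)" using d_H_commute[OF lip sq'(2) corner(1)] .
    also have "\<dots> = d_H H (0, 1) (t', 1)"
      by (rule d_H_eq_of_zero[OF lip corner(1,3) sq'(2)]) (simp add: d_H_sides)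
    finally show ?thesis using d_H_top[of 0 t'] t' by simp
  qed
  have b1: "d_H H b (1, 0) = len * (1 - t')"
  proof -
    have "d_H H b (1, 0) = d_H H (t', 1) (1, 0)" using eq corner by blast
    also have "\<dots> = d_H H (1, 0) (t', 1)" using d_H_commute[OF lip sq'(2) corner(2)] .
    also have "\<dots> = d_H H (1, 1) (t', 1)"
      by (rule d_H_eq_of_zero[OF lip corner(2,4) sq'(2)]) (simp add: d_H_sides)
    also have "\<dots> = d_H H (t', 1) (1, 1)" using d_H_commute[OF lip corner(4) sq'(2)] .
    finally show ?thesis using d_H_top[of t' 1] t' by simp
  qed
  \<comment> \<open>If \<open>b\<close> lies on \<open>c1\<close>, its distance to \<open>a\<close>
    is at most \<open>len * t + \<epsilon> - len * t'\<close>; on \<open>c2\<close> the same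
    computation is made from the other end. The second \<open>len * \<epsilon>\<close> in the final
    bound is the way from \<open>(t', 1)\<close> to \<open>(t, 1)\<close>.\<close>
  have "d_H H b a \<le> \<epsilon> + len * \<epsilon>"
  proof -
    have "b \<in> c1 ` {0..1} \<union> c2 ` {0..1}" using j(2) x(1) unfolding b_def by blast
    then show ?thesis
    proof
      assume "b \<in> c1 ` {0..1}"
      then obtain z where z: "z \<in> {0..1}" "b = c1 z" by blast
      have "d_H H (0, 0) b + d_H H b a \<le> len * t + \<epsilon>"
        unfolding z(2) using len t \<open>\<epsilon> > 0\<close> c1 by (intro d_H_add_le_length[OF lip c1(1) z(1)]) auto
      then show ?thesis using b0 ltt by linarith
    next
      assume "b \<in> c2 ` {0..1}"
      then obtain z where z: "z \<in> {0..1}" "b = c2 z" by blast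
      have "d_H H a b + d_H H b (1, 0) \<le> len * (1 - t) + \<epsilon>"
        unfolding z(2) using len t \<open>\<epsilon> > 0\<close> c2 by (intro d_H_add_le_length[OF lip c2(1) z(1)]) auto
      then show ?thesis using b1 ltt d_H_commute[OF lip a bsq] by (simp add: algebra_simps)
    qed
  qed
  moreover have "d_H H b (t, 1) \<le> len * \<epsilon>"
    using eq[OF sq'(1)] d_H_top[of t' t] t t' len by (simp add: mult_left_mono)
  ultimately show ?thesis
    using d_H_triangle[OF lip a bsq sq'(1)] d_H_commute[OF lip a bsq] by (simp add: algebra_simps)
qed

text \<open>For \<open>len > 0\<close> the bound of \<open>geodesic_point_near_top\<close> holds for
  every \<open>\<epsilon>\<close>, so the distance to \<open>(t, 1)\<close> is 0. For
  \<open>len = 0\<close> both points are at distance 0 from \<open>(0, 0)\<close>.\<close>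

lemma geodesic_point_eq_top:
  assumes a: "a \<in> unit_square" and t: "t \<in> {0..1}"
    and d: "d_H H (0, 0) a = len * t" "d_H H a (1, 0) = len * (1 - t)"
  shows "H a = \<gamma>_inf t"
proof -
  have sq: "(t, 1) \<in> unit_square" "(0, 0) \<in> unit_square" "(0, 1) \<in> unit_square" using t by (auto simp: unit_square_def)
  have "d_H H a (t, 1) \<le> 0"
  proof (cases "len = 0")
    case True
    have "d_H H (0, 0) (t, 1) = 0"
      using d_H_eq_of_zero[OF lip sq(2,3,1)] d_H_top[of 0 t] d_H_sides[of 0 1] t True by simp
    then show ?thesis
      using d_H_triangle[OF lip a sq(2,1)] d d_H_commute[OF lip a sq(2)] True by simp
  next
    case False
    then have len: "len > 0" using len_nonneg by simp
    show ?thesis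
    proof (rule field_le_epsilon)
      fix e :: real assume "e > 0"
      then show "d_H H a (t, 1) \<le> 0 + e"
        using geodesic_point_near_top[OF len a t d, of "e / (1 + 2 * len)"] len by simp
    qed
  qed
  then have "dist (H a) (H (t, 1)) \<le> 0" using dist_le_d_H[OF lip a sq(1)] by linarith
  then show ?thesis using boundary(2)[OF t] by simp
qed

lemma d_H_bottom_corners: "d_H H (0, 0) (1, 0) = len"
proof -
  have sq: "(0, 0) \<in> unit_square" "(1, 0) \<in> unit_square" "(0, 1) \<in> unit_square" "(1, 1) \<in> unit_square"
    by (auto simp: unit_square_def)
  have "d_H H (0, 0) (1, 0) = d_H H (0, 1) (1, 0)"
    by (rule d_H_eq_of_zero[OF lip sq(1,3,2)]) (simp add: d_H_sides)
  also have "\<dots> = d_H H (1, 0) (0, 1)" using d_H_commute[OF lip sq(3,2)] .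
  also have "\<dots> = d_H H (1, 1) (0, 1)"
    by (rule d_H_eq_of_zero[OF lip sq(2,4,3)]) (simp add: d_H_sides)
  finally show ?thesis using d_H_top[of 1 0] by simp
qed

lemma geodesic_projects_to_top:
  assumes \<eta>: "geodesic (tree H) (tree_dist H) (tree_psi H (0, 0)) (tree_psi H (1, 0)) \<eta>" and t: "t \<in> {0..1}"
  shows "tree_phi H (\<eta> t) = \<gamma>_inf t"
proof -
  have sq: "(0, 0) \<in> unit_square" "(1, 0) \<in> unit_square" by (auto simp: unit_square_def)
  have "\<eta> t \<in> tree H" using \<eta> t unfolding geodesic_def by blast
  then obtain a where a: "a \<in> unit_square" "\<eta> t = tree_psi H a" by (rule treeE)
  have "tree_dist H (\<eta> r) (\<eta> r') = len * \<bar>r' - r\<bar>" if "r \<in> {0..1}" "r' \<in> {0..1}" for r r'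
    using \<eta> that unfolding geodesic_def by (simp add: tree_dist_psi[OF lip sq] d_H_bottom_corners)
  from this[of 0 t] this[of t 1] t
  have "tree_dist H (\<eta> 0) (\<eta> t) = len * t" "tree_dist H (\<eta> t) (\<eta> 1) = len * (1 - t)"
    by simp_all
  moreover have "\<eta> 0 = tree_psi H (0, 0)" "\<eta> 1 = tree_psi H (1, 0)"
    using \<eta> unfolding geodesic_def by auto
  ultimately have "d_H H (0, 0) a = len * t" "d_H H a (1, 0) = len * (1 - t)"
    using a sq by (simp_all add: tree_dist_psi[OF lip])
  then show ?thesis
    using geodesic_point_eq_top[OF a(1) t] tree_phi_psi[OF lip a(1)] a(2) by simp
qed

lemma dist_top_le:
  assumes "t \<in> {0..1}" "t' \<in> {0..1}"
  shows "dist (\<gamma>_inf t) (\<gamma>_inf t') \<le> len * \<bar>t' - t\<bar>"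
  using dist_le_d_H[OF lip, of "(t, 1)" "(t', 1)"] assms by (simp add: d_H_top boundary(2) in_square)

text \<open>Taking the bottom edge itself as \<open>c\<close>, each value of
  \<open>\<gamma>_inf\<close> is approximated by values which \<open>\<gamma>\<close> shares;
  compactness of the image of \<open>\<gamma>\<close> does the rest.\<close>

lemma top_image_subset:
  assumes \<gamma>: "lipschitz_path \<gamma>"
  shows "\<gamma>_inf ` {0..1} \<subseteq> \<gamma> ` {0..1}"
proof
  fix y assume "y \<in> \<gamma>_inf ` {0..1}"
  then obtain t where t: "t \<in> {0..1}" "y = \<gamma>_inf t" by blast
  show "y \<in> \<gamma> ` {0..1}"
  proof (cases "len = 0")
    case True
    have "\<gamma>_inf t = \<gamma>_inf 0" using dist_top_le[of t 0] t True by simp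
    also have "\<dots> = \<gamma> 0" using boundary(2)[of 0] boundary(3)[of 1] by simp
    finally show ?thesis using t by auto
  next
    case False
    then have len: "len > 0" using len_nonneg by simp
    have "compact (\<gamma> ` {0..1})"
      using \<gamma> by (auto simp: lipschitz_path_def intro!: compact_continuous_image lipschitz_on_continuous_on)
    moreover have "\<exists>z \<in> \<gamma> ` {0..1}. dist z y < e" if "e > 0" for e
    proof -
      \<comment> \<open>\<open>\<gamma>_inf\<close> is \<open>len\<close>-Lipschitz, so this radius
        gives an error of at most \<open>e / 2\<close>, which keeps the inequality strict.\<close>
      have e: "e / (2 * len) > 0" using that len by simp
      obtain u v where uv: "0 \<le> u" "u < v" "v \<le> 1" "t - e / (2 * len) \<le> u" "v \<le> t + e / (2 * len)"
        using small_interval[OF t(1) e] by blast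
      obtain x t' where x: "x \<in> {0..1}" "u < t'" "t' < v" "d_H H (x, 0) (t', 1) = 0"
        using path_meets_top[OF len lipschitz_path_square_horizontal[of 0] uv(1-3)] by auto
      have t': "t' \<in> {0..1}" "\<bar>t - t'\<bar> \<le> e / (2 * len)" using x uv by auto
      have "\<gamma> x = \<gamma>_inf t'"
        using dist_le_d_H[OF lip, of "(x, 0)" "(t', 1)"] x t' by (simp add: boundary in_square)
      moreover have "dist (\<gamma>_inf t') y \<le> len * (e / (2 * len))"
        unfolding t(2) by (rule order_trans[OF dist_top_le[OF t'(1) t(1)] mult_left_mono[OF t'(2) len_nonneg]])
      moreover have "len * (e / (2 * len)) < e" using len that by simp
      ultimately show ?thesis using x(1) by (metis image_eqI le_less_trans)
    qed
    ultimately show ?thesis by (meson closed_approachable compact_imp_closed)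
  qed
qed

end

theorem theorem3p10:
  fixes \<gamma>\<^sub>0 \<gamma>_inf \<gamma> :: "real \<Rightarrow> 'a::metric_space"
    and H :: "real \<times> real \<Rightarrow> 'a"
  assumes "purely_2_unrectifiable (UNIV :: 'a set)"
    and "lipschitz_path \<gamma>\<^sub>0"
    and "length_minimizer (homotopy_class \<gamma>\<^sub>0) \<gamma>_inf"
    and "arc_length_parametrized \<gamma>_inf"
    and "lipschitz_path \<gamma>"
    and "homotopic_rel_endpoints \<gamma> \<gamma>_inf"
    and "lipschitz_homotopy \<gamma> \<gamma>_inf H"
  shows "(\<forall>\<eta>. geodesic (tree H) (tree_dist H) (tree_psi H (0, 0)) (tree_psi H (1, 0)) \<eta> \<longrightarrow>
            (\<forall>t \<in> {0..1}. (tree_phi H \<circ> \<eta>) t = \<gamma>_inf t)) \<and>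
         \<gamma>_inf ` {0..1} \<subseteq> \<gamma> ` {0..1}"
proof -
  have cls: "homotopic_rel_endpoints \<gamma>_inf \<gamma>\<^sub>0" and lip: "lipschitz_path \<gamma>_inf"
    and min: "\<And>\<alpha>. homotopic_rel_endpoints \<alpha> \<gamma>\<^sub>0 \<Longrightarrow> path_length \<gamma>_inf \<le> path_length \<alpha>"
    using assms(3) unfolding length_minimizer_def homotopy_class_def
    by (auto simp: homotopic_rel_endpoints_def intro: INF_lower)
  interpret shortest_top_edge \<gamma> \<gamma>_inf H
  proof
    fix c assume "lipschitz_path_square (0, 1) (1, 1) c"
    \<comment> \<open>Pushing to the top gives a homotopy to \<open>\<gamma>_inf\<close>;
      transitivity carries it to the class of \<open>\<gamma>\<^sub>0\<close>, over which the
      minimum is taken.\<close>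
    then have "homotopic_rel_endpoints (H \<circ> c) \<gamma>\<^sub>0"
      using homotopic_rel_endpoints_trans[OF homotopic_push_to_top[OF assms(7) _ lip] cls] by blast
    then show "path_length \<gamma>_inf \<le> path_length (H \<circ> c)" by (rule min)
  qed (use assms lip in auto)
  show ?thesis
    using geodesic_projects_to_top top_image_subset[OF assms(5)] by auto
qed

end
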